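(* Let $G$ be a connected Lie group, let $\mathcal{G}$ be a left-invariant (Riemannian) metric tensor field on $G$, and let $\nu \in \mathbb{R}$. Let $\{\mathcal{A}_i\}_i$ be a left-invariant frame on $G$, let $c_{ij}^k$ be the structure constants defined by $c_{ij}^k \mathcal{A}_k = [\mathcal{A}_i, \mathcal{A}_j]$, let $g^{ij}$ be the components of the dual metric $\mathcal{G}^{-1}$ with respect to this frame, and let $\Gamma_{ij}^k$ be the Christoffel symbols of the Levi-Civita connection of $\mathcal{G}$ with respect to this frame. Then, as operators on smooth functions on $G$ (summing over repeated indices), the Lie-Cartan Laplacian $\Delta_{\mathcal{G},\nu}$ is given by $$\Delta_{\mathcal{G},\nu} = g^{ij}\mathcal{A}_i\mathcal{A}_j + \nu\, c_{ki}^k\, g^{ij}\mathcal{A}_j,$$ while the Laplace-Beltrami operator $\Delta_{\mathcal{G}}$ is given by $$\Delta_{\mathcal{G}} = g^{ij}\mathcal{A}_i\mathcal{A}_j + \Gamma_{ki}^k\, g^{ij}\mathcal{A}_j = g^{ij}\mathcal{A}_i\mathcal{A}_j + c_{ki}^k\, g^{ij}\mathcal{A}_j .$$ The difference is $$\Delta_{\mathcal{G}} - \Delta_{\mathcal{G},\nu} = (1-\nu)\, c_{ki}^k\, g^{ij}\mathcal{A}_j .$$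
   Context: The Einstein summation convention is used throughout. A left-invariant frame $\{\mathcal{A}_i\}_i$ on a Lie group $G$ is a basis of the space of left-invariant vector fields $\mathfrak{X}(G)$. For a left-invariant metric tensor field $\mathcal{G}$, the components $g_{ij} = \mathcal{G}(\mathcal{A}_i,\mathcal{A}_j)$ are constants and $(g^{ij})$ is the inverse matrix of $(g_{ij})$. The gradient of a smooth function $U$ is $\nabla_{\mathcal{G}} U = g^{ij}(\mathcal{A}_i U)\mathcal{A}_j$. The Christoffel symbols with respect to the frame are given by $\nabla^{\mathrm{LC}}_{\mathcal{A}_i}\mathcal{A}_j = \Gamma_{ij}^k\mathcal{A}_k$, where $\nabla^{\mathrm{LC}}$ is the Levi-Civita connection of $\mathcal{G}$. Generalised Laplacian: for a Riemannian manifold $(M,\mathcal{G})$ and an affine connection $\nabla$ on $M$, define the divergence of a smooth vector field $X$ by $\mathrm{div}_\nabla(X) = \mathrm{trace}(\nabla_{\cdot}X)$, i.e. the pointwise trace of the endomorphism $Z \mapsto \nabla_Z X$, and define $\Delta_{\mathcal{G},\nabla} U = \mathrm{div}_\nabla(\nabla_{\mathcal{G}} U)$. The Laplace-Beltrami operator is $\Delta_{\mathcal{G}} = \mathrm{div}_{\mathcal{G}} \circ \nabla_{\mathcal{G}}$, with $\mathrm{div}_{\mathcal{G}}$ the Riemannian divergence, which equals $\mathrm{div}_{\nabla^{\mathrm{LC}}}$. Lie-Cartan connection: for $\nu\in\mathbb{R}$, the $\nu$ Lie-Cartan connection $\nabla^{[\nu]}$ on $G$ is the affine connection such that $\nabla^{[\nu]}_X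 Y = \nu[X,Y]$ for all left-invariant vector fields $X,Y \in \mathfrak{X}(G)$. The Lie-Cartan Laplacian is $\Delta_{\mathcal{G},\nu} = \Delta_{\mathcal{G},\nabla^{[\nu]}}$. *)

theory Defs
  imports "HOL-Analysis.Analysis" "HOL-Library.Function_Algebras"
begin

subsection \<open>Function spaces as real vector spaces\<close>

text \<open>
  With pointwise scalar multiplication next to the pointwise ring operations of
  \<^theory>\<open>HOL-Library.Function_Algebras\<close>, the library notions \<^const>\<open>span\<close>, \<^const>\<open>independent\<close> and
  \<^const>\<open>representation\<close> apply to spaces of tangent vectors and of vector fields.
\<close>

instantiation "fun" :: (type, real_vector) real_vector
begin

definition scaleR_fun :: "real \<Rightarrow> ('a \<Rightarrow> 'b) \<Rightarrow> 'a \<Rightarrow> 'b"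
  where "scaleR_fun r f = (\<lambda>x. r *\<^sub>R f x)"

instance
  by standard (simp_all add: scaleR_fun_def fun_eq_iff scaleR_add_right scaleR_add_left)

end

lemma scaleR_fun_apply [simp]: "(r *\<^sub>R f) x = r *\<^sub>R f x"
  by (simp add: scaleR_fun_def)

lemma sum_fun_apply: "(\<Sum>i\<in>I. f i) x = (\<Sum>i\<in>I. f i x)"
  by (induction I rule: infinite_finite_induct) simp_all

text \<open>
  Trace of an endomorphism \<open>T\<close> of a finite-dimensional subspace \<open>V\<close>, computed in some basis of \<open>V\<close>.
\<close>

definition endo_trace :: "'v::real_vector set \<Rightarrow> ('v \<Rightarrow> 'v) \<Rightarrow> real"
  where "endo_trace V T =
    (let B = (SOME B. independent B \<and> span B = V) in \<Sum>b\<in>B. representation B (T b) b)"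

text \<open>\<open>h\<close> is the inverse of the Gram matrix \<open>b (e i) (e j)\<close>.\<close>

definition inverse_gram :: "'i set \<Rightarrow> ('i \<Rightarrow> 'v) \<Rightarrow> ('v \<Rightarrow> 'v \<Rightarrow> real) \<Rightarrow> ('i \<Rightarrow> 'i \<Rightarrow> real) \<Rightarrow> bool"
  where "inverse_gram I e b h \<longleftrightarrow>
    (\<forall>i\<in>I. \<forall>j\<in>I.
      (\<Sum>k\<in>I. h i k * b (e k) (e j)) = (if i = j then 1 else 0) \<and>
      (\<Sum>k\<in>I. b (e i) (e k) * h k j) = (if i = j then 1 else 0))"


subsection \<open>Smooth manifolds\<close>

text \<open>
  Iterated directional derivatives; over a finite-dimensional domain and on open sets this is the
  usual notion of a map of class \<open>C\<^sup>k\<close>.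
\<close>

primrec Ck_on :: "nat \<Rightarrow> 'a::real_normed_vector set \<Rightarrow> ('a \<Rightarrow> 'b::real_normed_vector) \<Rightarrow> bool"
  where
    "Ck_on 0 S f \<longleftrightarrow> continuous_on S f"
  | "Ck_on (Suc k) S f \<longleftrightarrow>
      (\<forall>x\<in>S. f differentiable (at x)) \<and> (\<forall>v. Ck_on k S (\<lambda>x. frechet_derivative f (at x) v))"

definition smooth_on :: "'a::real_normed_vector set \<Rightarrow> ('a \<Rightarrow> 'b::real_normed_vector) \<Rightarrow> bool"
  where "smooth_on S f \<longleftrightarrow> (\<forall>k. Ck_on k S f)"

text \<open>
  An atlas is a set of charts, given as pairs of a domain and a coordinate map, the inverse of the
  latter being \<^const>\<open>inv_into\<close>. The model space is an arbitrary finite-dimensional real inner product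
  space: types of class \<^class>\<open>euclidean_space\<close> have positive dimension, which would exclude
  zero-dimensional manifolds.
\<close>

type_synonym ('g, 'b) atlas = "('g set \<times> ('g \<Rightarrow> 'b)) set"

locale smooth_manifold =
  fixes M :: "('g::{t2_space, second_countable_topology}, 'b::real_inner) atlas"
  assumes finite_dimensional: "\<exists>B::'b set. finite B \<and> span B = UNIV"
    and chart: "(U, \<phi>) \<in> M \<Longrightarrow>
      open U \<and> open (\<phi> ` U) \<and> homeomorphism U (\<phi> ` U) \<phi> (inv_into U \<phi>)"
    and cover: "\<exists>(U, \<phi>)\<in>M. p \<in> U"
    and compatible: "(U, \<phi>) \<in> M \<Longrightarrow> (V, \<psi>) \<in> M \<Longrightarrow>
      smooth_on (\<phi> ` (U \<inter> V)) (\<psi> \<circ> inv_into U \<phi>)"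

definition prod_atlas :: "('g, 'b) atlas \<Rightarrow> ('h, 'c) atlas \<Rightarrow> ('g \<times> 'h, 'b \<times> 'c) atlas"
  where "prod_atlas M N = {(U \<times> V, map_prod \<phi> \<psi>) | U \<phi> V \<psi>. (U, \<phi>) \<in> M \<and> (V, \<psi>) \<in> N}"

definition smooth_map ::
    "('g::topological_space, 'b::real_normed_vector) atlas \<Rightarrow>
     ('h::topological_space, 'c::real_normed_vector) atlas \<Rightarrow> ('g \<Rightarrow> 'h) \<Rightarrow> bool"
  where "smooth_map M N F \<longleftrightarrow> continuous_on UNIV F \<and>
    (\<forall>(U, \<phi>)\<in>M. \<forall>(V, \<psi>)\<in>N. smooth_on (\<phi> ` (U \<inter> F -` V)) (\<psi> \<circ> F \<circ> inv_into U \<phi>))"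

definition smooth_functions :: "('g, 'b::real_normed_vector) atlas \<Rightarrow> ('g \<Rightarrow> real) set"
  where "smooth_functions M = {f. \<forall>(U, \<phi>)\<in>M. smooth_on (\<phi> ` U) (f \<circ> inv_into U \<phi>)}"


subsection \<open>Tangent vectors and vector fields\<close>

text \<open>
  Tangent vectors at \<open>p\<close> are derivations at \<open>p\<close> of the algebra of smooth functions. As functions in HOL
  are total, they are made to vanish on non-smooth arguments, so that equality of tangent vectors is
  equality on smooth functions.
\<close>

type_synonym 'g tangent = "('g \<Rightarrow> real) \<Rightarrow> real"

definition tangent_space :: "('g, 'b::real_normed_vector) atlas \<Rightarrow> 'g \<Rightarrow> 'g tangent set"
  where "tangent_space M p = {v.
    (\<forall>f\<in>smooth_functions M. \<forall>h\<in>smooth_functions M. v (f + h) = v f + v h) \<and>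
    (\<forall>r. \<forall>f\<in>smooth_functions M. v (r *\<^sub>R f) = r * v f) \<and>
    (\<forall>f\<in>smooth_functions M. \<forall>h\<in>smooth_functions M. v (f * h) = f p * v h + h p * v f) \<and>
    (\<forall>f. f \<notin> smooth_functions M \<longrightarrow> v f = 0)}"

text \<open>The differential of \<open>F\<close>, for a smooth map \<open>F\<close> from \<open>M\<close> to itself.\<close>

definition pushforward :: "('g, 'b::real_normed_vector) atlas \<Rightarrow> ('g \<Rightarrow> 'g) \<Rightarrow> 'g tangent \<Rightarrow> 'g tangent"
  where "pushforward M F v = (\<lambda>f. if f \<in> smooth_functions M then v (f \<circ> F) else 0)"

type_synonym 'g vector_field = "'g \<Rightarrow> 'g tangent"

definition vf_apply :: "'g vector_field \<Rightarrow> ('g \<Rightarrow> real) \<Rightarrow> 'g \<Rightarrow> real"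
  where "vf_apply X f = (\<lambda>p. X p f)"

definition vector_fields :: "('g, 'b::real_normed_vector) atlas \<Rightarrow> 'g vector_field set"
  where "vector_fields M = {X. (\<forall>p. X p \<in> tangent_space M p) \<and>
    (\<forall>f\<in>smooth_functions M. vf_apply X f \<in> smooth_functions M)}"

definition fun_scale :: "('g \<Rightarrow> real) \<Rightarrow> 'g vector_field \<Rightarrow> 'g vector_field"
  where "fun_scale f X = (\<lambda>p. f p *\<^sub>R X p)"

definition lie_bracket :: "'g vector_field \<Rightarrow> 'g vector_field \<Rightarrow> 'g vector_field"
  where "lie_bracket X Y = (\<lambda>p f. X p (vf_apply Y f) - Y p (vf_apply X f))"


subsection \<open>Metrics, connections and Laplacians\<close>

type_synonym 'g metric_tensor = "'g \<Rightarrow> 'g tangent \<Rightarrow> 'g tangent \<Rightarrow> real"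

definition riemannian_metric ::
    "('g, 'b::real_normed_vector) atlas \<Rightarrow> 'g metric_tensor \<Rightarrow> bool"
  where "riemannian_metric M g \<longleftrightarrow>
    (\<forall>p. \<forall>u\<in>tangent_space M p. \<forall>v\<in>tangent_space M p. \<forall>w\<in>tangent_space M p. \<forall>r s.
      g p (r *\<^sub>R u + s *\<^sub>R v) w = r * g p u w + s * g p v w) \<and>
    (\<forall>p. \<forall>v\<in>tangent_space M p. \<forall>w\<in>tangent_space M p. g p v w = g p w v) \<and>
    (\<forall>p. \<forall>v\<in>tangent_space M p. v \<noteq> 0 \<longrightarrow> g p v v > 0) \<and>
    (\<forall>X\<in>vector_fields M. \<forall>Y\<in>vector_fields M. (\<lambda>p. g p (X p) (Y p)) \<in> smooth_functions M)"

definition gradient ::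
    "('g, 'b::real_normed_vector) atlas \<Rightarrow> 'g metric_tensor \<Rightarrow> ('g \<Rightarrow> real) \<Rightarrow> 'g vector_field"
  where "gradient M g U =
    (\<lambda>p. THE v. v \<in> tangent_space M p \<and> (\<forall>w\<in>tangent_space M p. g p v w = w U))"

lemma subspace_tangent_space: "subspace (tangent_space M p)"
  by (auto simp: subspace_def tangent_space_def algebra_simps)

text \<open>In every frame this is the formula \<open>g\<^sup>i\<^sup>j (e\<^sub>i U) e\<^sub>j\<close>.\<close>

lemma gradient_frame:
  assumes g: "riemannian_metric M g" and I: "finite I"
    and span: "span (e ` I) = tangent_space M p"
    and h: "inverse_gram I e (g p) h"
  shows "gradient M g U p = (\<Sum>i\<in>I. \<Sum>j\<in>I. (h i j * e i U) *\<^sub>R e j)"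
proof -
  let ?T = "tangent_space M p"
  define v where "v = (\<Sum>i\<in>I. \<Sum>j\<in>I. (h i j * e i U) *\<^sub>R e j)"
  have e: "e i \<in> ?T" if "i \<in> I" for i
    using span span_base[of "e i" "e ` I"] that by auto
  have T0: "0 \<in> ?T" by (rule subspace_0[OF subspace_tangent_space])
  have lin: "g p (r *\<^sub>R u + s *\<^sub>R v) w = r * g p u w + s * g p v w"
    if "u \<in> ?T" "v \<in> ?T" "w \<in> ?T" for u v w r s
    using g that unfolding riemannian_metric_def by blast
  have sym: "g p u w = g p w u" if "u \<in> ?T" "w \<in> ?T" for u w
    using g that unfolding riemannian_metric_def by blast
  have pos: "g p u u > 0" if "u \<in> ?T" "u \<noteq> 0" for u
    using g that unfolding riemannian_metric_def by blast
  have add: "g p (u + v) w = g p u w + g p v w" if "u \<in> ?T" "v \<in> ?T" "w \<in> ?T" for u v w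
    using lin[of u v w 1 1] that by simp
  have scale: "g p (r *\<^sub>R u) w = r * g p u w" if "u \<in> ?T" "w \<in> ?T" for u w r
    using lin[of u u w r 0] that by simp
  have zero: "g p 0 w = 0" if "w \<in> ?T" for w
    using scale[of 0 w 0] T0 that by simp
  have sum: "g p (\<Sum>i\<in>J. f i) w = (\<Sum>i\<in>J. g p (f i) w)"
    if "\<And>i. i \<in> J \<Longrightarrow> f i \<in> ?T" "w \<in> ?T" for J :: "'c set" and f w
    using that
    by (induction J rule: infinite_finite_induct)
      (auto simp: zero add subspace_sum[OF subspace_tangent_space])
  have eT: "c *\<^sub>R e i \<in> ?T" if "i \<in> I" for c i
    using subspace_scale[OF subspace_tangent_space e[OF that]] .
  have vT: "v \<in> ?T"
    unfolding v_def by (intro subspace_sum[OF subspace_tangent_space] eT)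
  have ve: "g p v (e k) = e k U" if k: "k \<in> I" for k
  proof -
    have "g p v (e k) = (\<Sum>i\<in>I. \<Sum>j\<in>I. h i j * e i U * g p (e j) (e k))"
      unfolding v_def
      by (subst sum; (simp add: e k eT subspace_sum[OF subspace_tangent_space])?)
        (intro sum.cong refl, subst sum; simp add: e k eT scale)
    also have "\<dots> = (\<Sum>i\<in>I. e i U * (\<Sum>j\<in>I. h i j * g p (e j) (e k)))"
      by (simp add: sum_distrib_left mult_ac)
    also have "\<dots> = (\<Sum>i\<in>I. e i U * (if i = k then 1 else 0))"
      using h k unfolding inverse_gram_def by (intro sum.cong refl) simp
    also have "\<dots> = e k U"
      using I k by (simp add: if_distrib[of "(*) x" for x] cong: if_cong)
    finally show ?thesis .
  qed
  have vw: "g p v w = w U" if "w \<in> ?T" for w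
  proof -
    have "w \<in> span (e ` I)" using that span by simp
    then have "w \<in> ?T \<and> g p v w = w U"
    proof (induction rule: span_induct_alt)
      case base
      have "g p v 0 = 0 U" using sym[OF vT T0] zero[OF vT] by simp
      with T0 show ?case by (rule conjI)
    next
      case (step c x y)
      then obtain k where k: "k \<in> I" "x = e k" by blast
      have y: "y \<in> ?T" and yU: "g p v y = y U" using step(2) by auto
      have cy: "c *\<^sub>R x + y \<in> ?T"
        using subspace_add[OF subspace_tangent_space eT[OF k(1)] y] k(2) by simp
      have "g p v (c *\<^sub>R x + y) = g p (c *\<^sub>R x + 1 *\<^sub>R y) v"
        by (subst sym[OF vT cy]) simp
      also have "\<dots> = c * g p x v + 1 * g p y v"
        by (rule lin) (use e[OF k(1)] k(2) y vT in auto)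
      also have "g p x v = x U"
        using sym[OF e[OF k(1)] vT] ve[OF k(1)] k(2) by simp
      also have "g p y v = y U"
        using sym[OF y vT] yU by simp
      also have "c * x U + 1 * y U = (c *\<^sub>R x + y) U"
        by simp
      finally have "g p v (c *\<^sub>R x + y) = (c *\<^sub>R x + y) U" .
      with cy show ?case by (rule conjI)
    qed
    then show ?thesis ..
  qed
  have "gradient M g U p = v"
    unfolding gradient_def
  proof (rule the_equality)
    show "v \<in> ?T \<and> (\<forall>w\<in>?T. g p v w = w U)" by (intro conjI ballI vT vw)
  next
    fix u assume u: "u \<in> ?T \<and> (\<forall>w\<in>?T. g p u w = w U)"
    then have uT: "u \<in> ?T" and uw: "\<And>w. w \<in> ?T \<Longrightarrow> g p u w = w U" by auto
    have d: "u - v \<in> ?T" by (rule subspace_diff[OF subspace_tangent_space uT vT])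
    have "g p (1 *\<^sub>R u + (-1) *\<^sub>R v) (u - v) = 1 * g p u (u - v) + (-1) * g p v (u - v)"
      by (rule lin[OF uT vT d])
    also have "\<dots> = 0"
      unfolding uw[OF d] vw[OF d] by (simp only: mult_1 mult_minus_left add.right_inverse)
    also have "1 *\<^sub>R u + (-1) *\<^sub>R v = u - v"
      by (simp only: scaleR_one scaleR_minus_left diff_conv_add_uminus)
    finally have "\<not> g p (u - v) (u - v) > 0" by (simp only: less_irrefl not_False_eq_True)
    then have "u - v = 0" by (rule contrapos_np) (rule pos[OF d])
    then show "u = v" by (rule eq_iff_diff_eq_0[THEN iffD2])
  qed
  then show ?thesis unfolding v_def .
qed

type_synonym 'g connection = "'g vector_field \<Rightarrow> 'g vector_field \<Rightarrow> 'g vector_field"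

definition affine_connection :: "('g, 'b::real_normed_vector) atlas \<Rightarrow> 'g connection \<Rightarrow> bool"
  where "affine_connection M D \<longleftrightarrow>
    (\<forall>X\<in>vector_fields M. \<forall>Y\<in>vector_fields M. D X Y \<in> vector_fields M) \<and>
    (\<forall>X\<in>vector_fields M. \<forall>Y\<in>vector_fields M. \<forall>Z\<in>vector_fields M.
      D (X + Y) Z = D X Z + D Y Z \<and> D X (Y + Z) = D X Y + D X Z) \<and>
    (\<forall>f\<in>smooth_functions M. \<forall>X\<in>vector_fields M. \<forall>Y\<in>vector_fields M.
      D (fun_scale f X) Y = fun_scale f (D X Y) \<and>
      D X (fun_scale f Y) = fun_scale f (D X Y) + fun_scale (vf_apply X f) Y)"

definition levi_civita_connection ::
    "('g, 'b::real_normed_vector) atlas \<Rightarrow> 'g metric_tensor \<Rightarrow> 'g connection \<Rightarrow> bool"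
  where "levi_civita_connection M g D \<longleftrightarrow> affine_connection M D \<and>
    (\<forall>X\<in>vector_fields M. \<forall>Y\<in>vector_fields M. D X Y - D Y X = lie_bracket X Y) \<and>
    (\<forall>X\<in>vector_fields M. \<forall>Y\<in>vector_fields M. \<forall>Z\<in>vector_fields M.
      vf_apply X (\<lambda>p. g p (Y p) (Z p)) =
        (\<lambda>p. g p (D X Y p) (Z p) + g p (Y p) (D X Z p)))"

text \<open>
  The derivative of \<open>X\<close> at \<open>p\<close> in the direction of a single tangent vector \<open>v\<close>. The choice of the
  extension of \<open>v\<close> to a vector field is immaterial, since a connection is tensorial in its first argument.
\<close>

definition covariant_derivative_at ::
    "('g, 'b::real_normed_vector) atlas \<Rightarrow> 'g connection \<Rightarrow> 'g vector_field \<Rightarrow> 'g \<Rightarrow>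
     'g tangent \<Rightarrow> 'g tangent"
  where "covariant_derivative_at M D X p v = D (SOME Z. Z \<in> vector_fields M \<and> Z p = v) X p"

definition divergence ::
    "('g, 'b::real_normed_vector) atlas \<Rightarrow> 'g connection \<Rightarrow> 'g vector_field \<Rightarrow> 'g \<Rightarrow> real"
  where "divergence M D X = (\<lambda>p. endo_trace (tangent_space M p) (covariant_derivative_at M D X p))"

text \<open>For the Levi-Civita connection \<open>D\<close> of \<open>g\<close>, this is the Laplace-Beltrami operator.\<close>

definition laplacian ::
    "('g, 'b::real_normed_vector) atlas \<Rightarrow> 'g metric_tensor \<Rightarrow> 'g connection \<Rightarrow>
     ('g \<Rightarrow> real) \<Rightarrow> 'g \<Rightarrow> real"
  where "laplacian M g D U = divergence M D (gradient M g U)"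


subsection \<open>Lie groups\<close>

locale lie_group = smooth_manifold M + group mul one iv
  for M :: "('g::{t2_space, second_countable_topology}, 'b::real_inner) atlas"
    and mul :: "'g \<Rightarrow> 'g \<Rightarrow> 'g" and one :: 'g and iv :: "'g \<Rightarrow> 'g" +
  assumes smooth_mul: "smooth_map (prod_atlas M M) M (\<lambda>(a, b). mul a b)"
    and smooth_iv: "smooth_map M M iv"

definition left_invariant_fields ::
    "('g, 'b::real_normed_vector) atlas \<Rightarrow> ('g \<Rightarrow> 'g \<Rightarrow> 'g) \<Rightarrow> 'g vector_field set"
  where "left_invariant_fields M mul =
    {X \<in> vector_fields M. \<forall>a p. pushforward M (mul a) (X p) = X (mul a p)}"

definition left_invariant_metric ::
    "('g, 'b::real_normed_vector) atlas \<Rightarrow> ('g \<Rightarrow> 'g \<Rightarrow> 'g) \<Rightarrow> 'g metric_tensor \<Rightarrow> bool"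
  where "left_invariant_metric M mul g \<longleftrightarrow> riemannian_metric M g \<and>
    (\<forall>a p. \<forall>v\<in>tangent_space M p. \<forall>w\<in>tangent_space M p.
      g (mul a p) (pushforward M (mul a) v) (pushforward M (mul a) w) = g p v w)"

definition left_invariant_frame ::
    "('g, 'b::real_normed_vector) atlas \<Rightarrow> ('g \<Rightarrow> 'g \<Rightarrow> 'g) \<Rightarrow> 'i set \<Rightarrow>
     ('i \<Rightarrow> 'g vector_field) \<Rightarrow> bool"
  where "left_invariant_frame M mul I A \<longleftrightarrow> finite I \<and> inj_on A I \<and>
    independent (A ` I) \<and> span (A ` I) = left_invariant_fields M mul"

definition lie_cartan_connection ::
    "('g, 'b::real_normed_vector) atlas \<Rightarrow> ('g \<Rightarrow> 'g \<Rightarrow> 'g) \<Rightarrow> real \<Rightarrow> 'g connection \<Rightarrow> bool"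
  where "lie_cartan_connection M mul \<nu> D \<longleftrightarrow> affine_connection M D \<and>
    (\<forall>X\<in>left_invariant_fields M mul. \<forall>Y\<in>left_invariant_fields M mul.
      D X Y = \<nu> *\<^sub>R lie_bracket X Y)"

end

theory Submission
  imports Defs
begin

text \<open>
  Write \<open>A\<^sub>i\<close> for the frame, \<open>\<theta>\<^sup>k = g\<^sup>k\<^sup>l g(_, A\<^sub>l)\<close> for its dual coframe and let \<open>D\<close> be any affine
  connection. If \<open>A\<^sub>i\<close> is at every point a basis of the tangent space, then the trace in the divergence
  can be read off in this basis: \<open>div X = \<theta>\<^sup>k(D\<^bsub>A\<^sub>k\<^esub> X)\<close>. The gradient of \<open>U\<close> is \<open>u\<^sup>j A\<^sub>j\<close> with
  \<open>u\<^sup>j = g\<^sup>i\<^sup>j A\<^sub>i U\<close>, where the \<open>g\<^sup>i\<^sup>j\<close> are constants because frame and metric are left-invariant. The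
  Leibniz rule for \<open>D\<close> then leaves two terms (lemma \<open>laplacian_eq\<close>): \<open>A\<^sub>k u\<^sup>k\<close>, which is the common
  second-order part \<open>g\<^sup>i\<^sup>j A\<^sub>i A\<^sub>j U\<close>, and \<open>u\<^sup>j \<theta>\<^sup>k(D\<^bsub>A\<^sub>k\<^esub> A\<^sub>j)\<close>, a first-order part in which \<open>D\<close> only enters
  through the traces \<open>\<theta>\<^sup>k(D\<^bsub>A\<^sub>k\<^esub> A\<^sub>j)\<close>.

  For the Lie-Cartan connection these traces are \<open>\<nu> c\<^sub>k\<^sub>j\<^sup>k\<close> by definition, for the Levi-Civita connection
  they are \<open>\<Gamma>\<^sub>k\<^sub>j\<^sup>k\<close> by definition. The equality \<open>\<Gamma>\<^sub>k\<^sub>j\<^sup>k = c\<^sub>k\<^sub>j\<^sup>k\<close> (lemma \<open>levi_civita_trace\<close>) combines two facts.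
  As the torsion vanishes, \<open>c\<^sub>k\<^sub>j\<^sup>k = \<Gamma>\<^sub>k\<^sub>j\<^sup>k - \<Gamma>\<^sub>j\<^sub>k\<^sup>k\<close>. As \<open>D\<close> is metric and the \<open>g(A\<^sub>k, A\<^sub>l)\<close> are constant,
  \<open>g(D\<^bsub>A\<^sub>j\<^esub> A\<^sub>k, A\<^sub>l)\<close> is skew in \<open>k, l\<close>, hence its contraction \<open>\<Gamma>\<^sub>j\<^sub>k\<^sup>k\<close> with the symmetric \<open>g\<^sup>k\<^sup>l\<close> vanishes.

  The remaining point, and the one that uses the manifold structure, is that the \<open>A\<^sub>i\<close> span every tangent
  space (lemma \<open>span_frame\<close>). The frame only spans the space of left-invariant fields, so this says
  that each tangent vector \<open>v\<close> at \<open>p\<close> is the value of a left-invariant field. Translation determines the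
  field: transported to the unit element, \<open>v\<close> becomes some \<open>u\<close>, and the field must be
  \<open>q \<mapsto> (f \<mapsto> u (f \<circ> L\<^sub>q))\<close>. What has to be proved is that \<open>q \<mapsto> u (f \<circ> L\<^sub>q)\<close> is smooth. Since \<open>u\<close> is
  given as an abstract derivation of the algebra of global smooth functions, it is first identified with
  a directional derivative in a chart (lemma \<open>tangent_is_directional_derivative\<close>, by Hadamard's lemma
  and a bump function); then \<open>u (f \<circ> L\<^sub>q)\<close> is a partial derivative of the smooth function
  \<open>(q, r) \<mapsto> f (q r)\<close>, and as such smooth in \<open>q\<close>.
\<close>

section \<open>Maps of class \<open>C\<^sup>k\<close> on open sets\<close>

lemma Ck_on_cong:
  assumes "open S" "\<And>x. x \<in> S \<Longrightarrow> f x = g x" "Ck_on k S f"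
  shows "Ck_on k S g"
  using assms
proof (induction k arbitrary: f g)
  case 0
  then show ?case by (simp cong: continuous_on_cong_simp)
next
  case (Suc k)
  have diff: "g differentiable (at x)"
    and eq: "frechet_derivative f (at x) = frechet_derivative g (at x)" if "x \<in> S" for x
  proof -
    have f: "f differentiable (at x)" using Suc.prems that by simp
    then show "g differentiable (at x)"
      unfolding differentiable_def
      using has_derivative_transform_within_open[where f=f and g=g, OF _ \<open>open S\<close> that Suc.prems(2)] by blast
    show "frechet_derivative f (at x) = frechet_derivative g (at x)"
      by (rule frechet_derivative_transform_within_open[OF f \<open>open S\<close> that Suc.prems(2)])
  qed
  have "Ck_on k S (\<lambda>x. frechet_derivative g (at x) v)" for v
    by (rule Suc.IH[of "\<lambda>x. frechet_derivative f (at x) v"]) (use Suc.prems eq in auto)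
  with diff show ?case by simp
qed

lemma Ck_on_subset: "Ck_on k S f \<Longrightarrow> T \<subseteq> S \<Longrightarrow> Ck_on k T f"
  by (induction k arbitrary: f) (auto intro: continuous_on_subset)

lemma Ck_on_local:
  assumes "\<And>x. x \<in> S \<Longrightarrow> \<exists>T. open T \<and> x \<in> T \<and> Ck_on k T f"
  shows "Ck_on k S f"
  using assms
proof (induction k arbitrary: f)
  case 0
  show ?case
    by (simp, rule continuous_at_imp_continuous_on)
      (use 0 in \<open>auto simp: continuous_on_eq_continuous_at\<close>, metis continuous_on_eq_continuous_at)
next
  case (Suc k)
  have "Ck_on k S (\<lambda>x. frechet_derivative f (at x) v)" for v
    by (rule Suc.IH) (use Suc.prems in fastforce)
  then show ?case using Suc.prems by fastforce
qed

text \<open>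
  \<^const>\<open>Ck_on\<close> speaks about \<^const>\<open>frechet_derivative\<close>, which is the derivative of choice at each point.
  This rule accepts any family of derivatives instead, so that differentiation rules can be used. The set
  has to be open because the higher derivatives only depend on the first one near each point.
\<close>
lemma Ck_on_SucI:
  assumes "open S" "\<And>x. x \<in> S \<Longrightarrow> (f has_derivative f' x) (at x)"
    "\<And>v. Ck_on k S (\<lambda>x. f' x v)"
  shows "Ck_on (Suc k) S f"
proof -
  have "Ck_on k S (\<lambda>x. frechet_derivative f (at x) v)" for v
    by (rule Ck_on_cong[OF assms(1) _ assms(3)[of v]])
      (simp add: frechet_derivative_at[OF assms(2), symmetric])
  then show ?thesis using assms(2) by (auto simp: differentiable_def)
qed

lemma Ck_on_SucD:
  assumes "Ck_on (Suc k) S f"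
  shows "x \<in> S \<Longrightarrow> (f has_derivative frechet_derivative f (at x)) (at x)"
    and "Ck_on k S (\<lambda>x. frechet_derivative f (at x) v)"
  using assms by (auto simp: frechet_derivative_works)

lemma Ck_on_Suc_imp: "Ck_on (Suc k) S f \<Longrightarrow> Ck_on k S f"
proof (induction k arbitrary: f)
  case 0
  then show ?case
    by (auto intro!: continuous_at_imp_continuous_on differentiable_imp_continuous_within)
next
  case (Suc k)
  have "Ck_on k S (\<lambda>x. frechet_derivative f (at x) v)" for v
    by (rule Suc.IH) (use Suc.prems in simp)
  then show ?case using Suc.prems by simp
qed

lemma Ck_on_const: "Ck_on k S (\<lambda>x. c)"
  by (induction k arbitrary: c) auto

lemma Ck_on_linear_comp:
  assumes "open S" "bounded_linear L" "Ck_on k S f"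
  shows "Ck_on k S (\<lambda>x. L (f x))"
  using assms(3)
proof (induction k arbitrary: f)
  case 0
  then show ?case by (auto intro: bounded_linear.continuous_on[OF assms(2)])
next
  case (Suc k)
  show ?case
    by (rule Ck_on_SucI[OF assms(1), where f'="\<lambda>x v. L (frechet_derivative f (at x) v)"])
      (use Suc Ck_on_SucD[OF Suc.prems] in \<open>auto intro: bounded_linear.has_derivative[OF assms(2)]\<close>)
qed

lemma Ck_on_add:
  assumes "open S" "Ck_on k S f" "Ck_on k S h"
  shows "Ck_on k S (\<lambda>x. f x + h x)"
  using assms(2,3)
proof (induction k arbitrary: f h)
  case 0
  then show ?case by (auto intro: continuous_intros)
next
  case (Suc k)
  show ?case
    by (rule Ck_on_SucI[OF assms(1), where f'="\<lambda>x v. frechet_derivative f (at x) v + frechet_derivative h (at x) v"])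
      (use Suc Ck_on_SucD(1)[OF Suc.prems(1)] Ck_on_SucD(1)[OF Suc.prems(2)]
        in \<open>auto intro: has_derivative_add\<close>)
qed

lemma Ck_on_sum:
  assumes "open S" "\<And>i. i \<in> I \<Longrightarrow> Ck_on k S (f i)"
  shows "Ck_on k S (\<lambda>x. \<Sum>i\<in>I. f i x)"
  using assms(2)
  by (induction I rule: infinite_finite_induct) (auto intro: Ck_on_const Ck_on_add[OF assms(1)])

lemma Ck_on_scaleR:
  fixes a :: "'a::real_normed_vector \<Rightarrow> real"
  assumes "open S" "Ck_on k S a" "Ck_on k S f"
  shows "Ck_on k S (\<lambda>x. a x *\<^sub>R f x)"
  using assms(2,3)
proof (induction k arbitrary: a f)
  case 0
  then show ?case by (auto intro: continuous_intros)
next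
  case (Suc k)
  show ?case
  proof (rule Ck_on_SucI[OF assms(1), where f'="\<lambda>x v. a x *\<^sub>R frechet_derivative f (at x) v + frechet_derivative a (at x) v *\<^sub>R f x"])
    show "((\<lambda>x. a x *\<^sub>R f x) has_derivative
         (\<lambda>v. a x *\<^sub>R frechet_derivative f (at x) v + frechet_derivative a (at x) v *\<^sub>R f x)) (at x)"
      if "x \<in> S" for x
      by (rule has_derivative_scaleR)
        (use that Ck_on_SucD(1)[OF Suc.prems(1)] Ck_on_SucD(1)[OF Suc.prems(2)] in auto)
    show "Ck_on k S (\<lambda>x. a x *\<^sub>R frechet_derivative f (at x) v + frechet_derivative a (at x) v *\<^sub>R f x)" for v
      by (intro Ck_on_add[OF assms(1)] Suc.IH Ck_on_SucD(2) Suc.prems Ck_on_Suc_imp)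
  qed
qed

lemma Ck_on_id:
  assumes "open S" shows "Ck_on k S (\<lambda>x. x)"
proof (cases k)
  case (Suc j)
  show ?thesis unfolding Suc
    by (rule Ck_on_SucI[OF assms, where f'="\<lambda>x v. v"]) (auto intro: Ck_on_const)
qed auto

section \<open>Finite orthonormal frames\<close>

text \<open>
  Orthonormal bases of a finite-dimensional inner product space, dimension zero included. The expansion
  is the only form in which spanning is used, so it serves as the definition; it also forces linear
  independence of \<open>C\<close>.
\<close>
definition parseval_frame :: "'m::real_inner set \<Rightarrow> bool"
  where "parseval_frame C \<longleftrightarrow> finite C \<and> (\<forall>b\<in>C. norm b = 1) \<and> (\<forall>x. (\<Sum>b\<in>C. (x \<bullet> b) *\<^sub>R b) = x)"

lemma parseval_frame_exists:
  assumes "finite B" "span B = (UNIV :: 'm::real_inner set)"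
  shows "\<exists>C::'m set. parseval_frame C"
proof -
  obtain C where C: "finite C" "span C = (UNIV::'m set)" "pairwise orthogonal C"
    using basis_orthogonal[OF assms(1)] assms(2) by metis
  define D where "D = (\<lambda>b. b /\<^sub>R norm b) ` (C - {0})"
  have fin: "finite D" and nrm: "\<And>b. b \<in> D \<Longrightarrow> norm b = 1"
    using C(1) by (auto simp: D_def) (metis left_inverse norm_eq_zero)
  have orth: "a \<bullet> b = 0" if ab: "a \<in> D" "b \<in> D" "a \<noteq> b" for a b
  proof -
    obtain a' b' where "a' \<in> C" "b' \<in> C" "a = a' /\<^sub>R norm a'" "b = b' /\<^sub>R norm b'"
      using ab(1,2) by (auto simp: D_def)
    moreover from this ab(3) have "a' \<noteq> b'" by auto
    ultimately show ?thesis
      using C(3) by (simp add: pairwise_def orthogonal_def)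
  qed
  have "C \<subseteq> span D"
  proof
    fix x assume "x \<in> C"
    show "x \<in> span D"
    proof (cases "x = 0")
      case False
      then have "x /\<^sub>R norm x \<in> D" using \<open>x \<in> C\<close> by (auto simp: D_def)
      from span_scale[OF span_base[OF this], of "norm x"] False show ?thesis by simp
    qed (simp add: span_zero)
  qed
  then have UNIV: "span D = UNIV" using C(2) by (metis span_minimal subspace_span top.extremum_uniqueI)
  have "(\<Sum>b\<in>D. (x \<bullet> b) *\<^sub>R b) = x" for x
  proof -
    have "x \<in> span D" by (simp add: UNIV)
    then show ?thesis
    proof (induction rule: span_induct_alt)
      case (step c a y)
      have "(\<Sum>b\<in>D. (a \<bullet> b) *\<^sub>R b) = (\<Sum>b\<in>D. if b = a then a else 0)"
        by (rule sum.cong) (use orth[OF step(1)] nrm[OF step(1)] in \<open>auto simp: dot_square_norm\<close>)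
      also have "\<dots> = a" using fin step(1) by simp
      finally show ?case
        using step(2) by (simp add: inner_add_left scaleR_add_left sum.distrib flip: scaleR_scaleR scaleR_sum_right)
    qed simp
  qed
  then show ?thesis using fin nrm unfolding parseval_frame_def by blast
qed

lemma parseval_frame_real: "parseval_frame {1::real}"
  by (simp add: parseval_frame_def)

lemma parseval_frame_linear:
  assumes "parseval_frame C" "linear L"
  shows "L v = (\<Sum>b\<in>C. (v \<bullet> b) *\<^sub>R L b)"
proof -
  have "L v = L (\<Sum>b\<in>C. (v \<bullet> b) *\<^sub>R b)" using assms(1) by (simp add: parseval_frame_def)
  also have "\<dots> = (\<Sum>b\<in>C. (v \<bullet> b) *\<^sub>R L b)" by (simp add: linear_sum[OF assms(2)] linear_scale[OF assms(2)])
  finally show ?thesis .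
qed

text \<open>
  The ball is a closed part of the cube of all vectors with coordinates in \<open>[-r, r]\<close>, and the cube is a
  finite sum of segments, hence compact.
\<close>
lemma compact_cball_parseval:
  fixes C :: "'m::real_inner set"
  assumes C: "parseval_frame C"
  shows "compact (cball p r :: 'm set)"
proof -
  \<comment> \<open>the cube spanned by \<open>D\<close>; adding a vector to \<open>D\<close> adds a segment to the cube\<close>
  define Q where "Q D = {x. \<exists>t. (\<forall>b\<in>D. \<bar>t b\<bar> \<le> r) \<and> x = (\<Sum>b\<in>D. t b *\<^sub>R b)}" for D :: "'m set"
  have "finite C" using C by (simp add: parseval_frame_def)
  then have "compact (Q C)"
  proof (induction C)
    case empty
    then show ?case by (simp add: Q_def)
  next
    case (insert b D)
    have "Q (insert b D) = {x + y | x y. x \<in> (\<lambda>t. t *\<^sub>R b) ` {-r..r} \<and> y \<in> Q D}" (is "?L = ?R")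
    proof
      show "?L \<subseteq> ?R"
        using insert(1,2) by (fastforce simp: Q_def abs_le_iff)
      show "?R \<subseteq> ?L"
      proof
        fix z assume "z \<in> ?R"
        then obtain s t where s: "-r \<le> s" "s \<le> r" and t: "\<forall>b\<in>D. \<bar>t b\<bar> \<le> r"
          and z: "z = s *\<^sub>R b + (\<Sum>b\<in>D. t b *\<^sub>R b)"
          by (auto simp: Q_def)
        have "(\<Sum>c\<in>D. (t(b := s)) c *\<^sub>R c) = (\<Sum>b\<in>D. t b *\<^sub>R b)"
          by (rule sum.cong) (use insert(2) in auto)
        then have "z = (\<Sum>c\<in>insert b D. (t(b := s)) c *\<^sub>R c)"
          using insert(1,2) z by simp
        moreover have "\<forall>c\<in>insert b D. \<bar>(t(b := s)) c\<bar> \<le> r" using s t by auto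
        ultimately show "z \<in> ?L" unfolding Q_def by blast
      qed
    qed
    then show ?case
      using compact_sums[OF compact_continuous_image[of "{-r..r}" "\<lambda>t. t *\<^sub>R b"] insert.IH]
      by (simp add: continuous_intros)
  qed
  have "cball 0 r \<subseteq> Q C"
  proof
    fix x :: 'm assume x: "x \<in> cball 0 r"
    have "\<bar>x \<bullet> b\<bar> \<le> r" if "b \<in> C" for b
    proof -
      have "norm b = 1" using C that by (simp add: parseval_frame_def)
      then show ?thesis using Cauchy_Schwarz_ineq2[of x b] x by simp
    qed
    moreover have "x = (\<Sum>b\<in>C. (x \<bullet> b) *\<^sub>R b)" using C by (simp add: parseval_frame_def)
    ultimately show "x \<in> Q C" unfolding Q_def by blast
  qed
  then have "compact (Q C \<inter> cball 0 r)" "Q C \<inter> cball 0 r = cball 0 r"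
    using \<open>compact (Q C)\<close> by (auto intro: compact_Int_closed)
  then have "compact ((+) p ` cball 0 r)" using compact_translation by metis
  then show ?thesis by (simp add: cball_translation)
qed

section \<open>Composition of maps of class \<open>C\<^sup>k\<close>\<close>

text \<open>
  The derivative \<open>f'(h x) (h' x v)\<close> is taken in a direction that moves with \<open>x\<close>, whereas \<^const>\<open>Ck_on\<close> only
  controls derivatives in fixed directions. Expanding \<open>h' x v\<close> in an orthonormal frame turns it
  into a finite sum of products of coordinates of \<open>h' x v\<close> with partial derivatives of \<open>f\<close> at \<open>h x\<close>,
  to which the induction hypothesis applies.
\<close>
lemma Ck_on_compose:
  fixes f :: "'m::real_inner \<Rightarrow> 'c::real_normed_vector" and h :: "'a::real_normed_vector \<Rightarrow> 'm"
  assumes C: "parseval_frame (C :: 'm set)" and S: "open S" and sub: "h ` S \<subseteq> T"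
    and "Ck_on k T f" "Ck_on k S h"
  shows "Ck_on k S (\<lambda>x. f (h x))"
  using assms(4,5)
proof (induction k arbitrary: f)
  case 0
  then show ?case using sub by (auto intro: continuous_on_compose2)
next
  case (Suc k)
  let ?f' = "\<lambda>y. frechet_derivative f (at y)" and ?h' = "\<lambda>x. frechet_derivative h (at x)"
  have df: "(f has_derivative ?f' (h x)) (at (h x))" if "x \<in> S" for x
    using Ck_on_SucD(1)[OF Suc.prems(1)] sub that by blast
  show ?case
  proof (rule Ck_on_SucI[OF S, where f'="\<lambda>x v. ?f' (h x) (?h' x v)"])
    show "((\<lambda>x. f (h x)) has_derivative (\<lambda>v. ?f' (h x) (?h' x v))) (at x)" if "x \<in> S" for x
      using has_derivative_compose[OF Ck_on_SucD(1)[OF Suc.prems(2) that] df[OF that]] .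
    fix v
    have eq: "(\<Sum>b\<in>C. (?h' x v \<bullet> b) *\<^sub>R ?f' (h x) b) = ?f' (h x) (?h' x v)" if "x \<in> S" for x
      by (rule parseval_frame_linear[symmetric, OF C has_derivative_linear[OF df[OF that]]])
    have "Ck_on k S (\<lambda>x. \<Sum>b\<in>C. (?h' x v \<bullet> b) *\<^sub>R ?f' (h x) b)"
    proof (intro Ck_on_sum Ck_on_scaleR S)
      fix b
      show "Ck_on k S (\<lambda>x. ?h' x v \<bullet> b)"
        by (rule Ck_on_linear_comp[OF S bounded_linear_inner_left Ck_on_SucD(2)[OF Suc.prems(2)]])
      show "Ck_on k S (\<lambda>x. ?f' (h x) b)"
        by (rule Suc.IH[OF Ck_on_SucD(2)[OF Suc.prems(1)] Ck_on_Suc_imp[OF Suc.prems(2)]])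
    qed
    then show "Ck_on k S (\<lambda>x. ?f' (h x) (?h' x v))"
      by (rule Ck_on_cong[OF S eq, rotated])
  qed
qed

lemma Ck_on_affine:
  assumes S: "open S" and L: "bounded_linear L"
  shows "Ck_on k S (\<lambda>x. L x + c)"
  by (intro Ck_on_add S Ck_on_const Ck_on_linear_comp[OF S L] Ck_on_id)

text \<open>
  For an affine inner map the direction \<open>L v\<close> stays fixed and the induction is immediate. The
  applications are to slices \<open>y \<mapsto> (y, c)\<close> of products of charts and to translations.
\<close>
lemma Ck_on_compose_affine:
  fixes f :: "'m::real_normed_vector \<Rightarrow> 'c::real_normed_vector" and L :: "'a::real_normed_vector \<Rightarrow> 'm"
  assumes S: "open S" and L: "bounded_linear L" and sub: "(\<lambda>x. L x + c) ` S \<subseteq> T"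
    and "Ck_on k T f"
  shows "Ck_on k S (\<lambda>x. f (L x + c))"
  using assms(4)
proof (induction k arbitrary: f)
  case 0
  then show ?case using sub L
    by (auto intro!: continuous_on_compose2[of T f S "\<lambda>x. L x + c"] continuous_intros
         bounded_linear.continuous_on[OF L])
next
  case (Suc k)
  show ?case
  proof (rule Ck_on_SucI[OF S, where f'="\<lambda>x v. frechet_derivative f (at (L x + c)) (L v)"])
    show "((\<lambda>x. f (L x + c)) has_derivative (\<lambda>v. frechet_derivative f (at (L x + c)) (L v))) (at x)"
      if "x \<in> S" for x
      by (rule has_derivative_compose[where f="\<lambda>x. L x + c" and f'=L])
        (use sub that Ck_on_SucD(1)[OF Suc.prems] bounded_linear_imp_has_derivative[OF L]
          in \<open>auto intro: has_derivative_add_const\<close>)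
  qed (rule Suc.IH[OF Ck_on_SucD(2)[OF Suc.prems]])
qed

section \<open>Bump functions\<close>

text \<open>
  The function \<open>u\<^sup>n e\<^sup>-\<^sup>u\<close> at \<open>u = 1/t\<close>, extended by zero. The span of this family is closed under
  differentiation, which makes all derivatives at zero accessible at once.
\<close>
definition flat_exp :: "nat \<Rightarrow> real \<Rightarrow> real"
  where "flat_exp n t = (if t > 0 then inverse t ^ n * exp (- inverse t) else 0)"

lemma flat_exp_tendsto: "(flat_exp n \<longlongrightarrow> 0) (at 0)"
proof -
  have "((\<lambda>t. inverse t ^ n / exp (inverse t)) \<longlongrightarrow> (0::real)) (at_right 0)"
    by (rule filterlim_compose[OF tendsto_power_div_exp_0 filterlim_inverse_at_top_right])
  then have "(flat_exp n \<longlongrightarrow> 0) (at_right 0)"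
    by (rule Lim_transform_eventually)
      (auto simp: eventually_at_right_less flat_exp_def exp_minus field_simps
        intro!: eventually_mono[OF eventually_at_right_less])
  moreover have "(flat_exp n \<longlongrightarrow> 0) (at_left 0)"
    by (rule Lim_transform_eventually[OF tendsto_const])
      (auto simp: flat_exp_def eventually_at_filter)
  ultimately show ?thesis by (simp add: filterlim_at_split)
qed

lemma flat_exp_derivative:
  "(flat_exp n has_real_derivative flat_exp (n + 2) t - real n * flat_exp (n + 1) t) (at t)"
proof -
  consider "t > 0" | "t < 0" | "t = 0" by linarith
  then show ?thesis
  proof cases
    case 1
    have "((\<lambda>t. inverse t ^ n * exp (- inverse t)) has_real_derivative
        flat_exp (n + 2) t - real n * flat_exp (n + 1) t) (at t)"
      using 1 by (auto intro!: derivative_eq_intros simp: flat_exp_def)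
        (cases n; simp add: field_simps power2_eq_square)
    then show ?thesis
      by (rule has_field_derivative_transform_within_open[where S="{0<..}"])
        (use 1 in \<open>auto simp: flat_exp_def\<close>)
  next
    case 2
    have "((\<lambda>t. 0) has_real_derivative flat_exp (n + 2) t - real n * flat_exp (n + 1) t) (at t)"
      using 2 by (auto intro!: derivative_eq_intros simp: flat_exp_def)
    then show ?thesis
      by (rule has_field_derivative_transform_within_open[where S="{..<0}"])
        (use 2 in \<open>auto simp: flat_exp_def\<close>)
  next
    case 3
    \<comment> \<open>the difference quotient of \<open>flat_exp n\<close> at zero is \<open>flat_exp (n + 1)\<close>\<close>
    have "((\<lambda>h. (flat_exp n (0 + h) - flat_exp n 0) / h) \<longlongrightarrow> 0) (at 0)"
      by (rule Lim_transform_eventually[OF flat_exp_tendsto[of "Suc n"]])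
        (auto simp: flat_exp_def eventually_at_filter divide_inverse)
    then show ?thesis using 3 by (simp add: DERIV_def flat_exp_def)
  qed
qed

lemma Ck_on_flat_exp: "Ck_on k UNIV (flat_exp n)"
proof (induction k arbitrary: n)
  case 0
  then show ?case
    by (auto intro!: continuous_at_imp_continuous_on DERIV_isCont flat_exp_derivative)
next
  case (Suc k)
  show ?case
  proof (rule Ck_on_SucI[OF open_UNIV])
    show "(flat_exp n has_derivative (\<lambda>v. (flat_exp (n + 2) t + (- real n) *\<^sub>R flat_exp (n + 1) t) * v)) (at t)" for t
      using flat_exp_derivative[of n t] by (simp add: has_field_derivative_def)
    show "Ck_on k UNIV (\<lambda>t. (flat_exp (n + 2) t + (- real n) *\<^sub>R flat_exp (n + 1) t) * v)" for v
      by (intro Ck_on_linear_comp[OF open_UNIV bounded_linear_mult_left] Ck_on_add Ck_on_scaleR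
           Ck_on_const open_UNIV Suc.IH)
  qed
qed

lemma bump_function_exists:
  fixes p :: "'m::real_inner"
  assumes "r > 0"
  shows "\<exists>\<beta>::'m \<Rightarrow> real. smooth_on UNIV \<beta> \<and> \<beta> p = 1 \<and> (\<forall>x. x \<notin> cball p r \<longrightarrow> \<beta> x = 0)"
proof -
  define q where "q x = r\<^sup>2 - (x - p) \<bullet> (x - p)" for x
  have q: "Ck_on k UNIV q" for k
  proof (cases k)
    case 0
    then show ?thesis by (auto simp: q_def intro!: continuous_intros)
  next
    case (Suc j)
    show ?thesis
      unfolding Suc
    proof (rule Ck_on_SucI[OF open_UNIV])
      show "(q has_derivative (\<lambda>v. x \<bullet> (- 2 *\<^sub>R v) + 2 * (p \<bullet> v))) (at x)" for x
        unfolding q_def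
        by (auto intro!: derivative_eq_intros simp: algebra_simps inner_commute)
    qed (rule Ck_on_affine[OF open_UNIV bounded_linear_inner_left])
  qed
  define e where "e = flat_exp 0 (r\<^sup>2)"
  have e: "e > 0" using assms by (simp add: e_def flat_exp_def)
  define \<beta> where "\<beta> x = inverse e * flat_exp 0 (q x)" for x
  have "Ck_on k UNIV \<beta>" for k
    unfolding \<beta>_def
    by (intro Ck_on_linear_comp[OF open_UNIV bounded_linear_mult_right]
       Ck_on_compose[OF parseval_frame_real open_UNIV _ Ck_on_flat_exp q]) simp
  moreover have "\<beta> p = 1" using e by (simp add: \<beta>_def q_def flip: e_def)
  moreover have "\<beta> x = 0" if "x \<notin> cball p r" for x
  proof -
    have "r < norm (x - p)" using that by (simp add: dist_norm norm_minus_commute)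
    then have "q x < 0" using assms unfolding q_def dot_square_norm
      using power_strict_mono[of r "norm (x - p)" 2] by simp
    then show ?thesis by (simp add: \<beta>_def flat_exp_def)
  qed
  ultimately show ?thesis unfolding smooth_on_def by blast
qed

section \<open>Hadamard's lemma\<close>

text \<open>
  For a smooth \<open>F\<close>, the factors in Hadamard's lemma are \<open>\<integral> (\<partial>\<^sub>b F)(t x) dt\<close> over \<open>[0, 1]\<close>. Each
  differentiation under the integral sign produces another factor \<open>t\<close>, and the exponent \<open>m\<close> keeps
  count of them.
\<close>
definition radial_mean :: "nat \<Rightarrow> ('m::real_normed_vector \<Rightarrow> real) \<Rightarrow> 'm \<Rightarrow> real"
  where "radial_mean m F x = integral {0..1} (\<lambda>t. t ^ m * F (t *\<^sub>R x))"

lemma scaleR_in_ball_0: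
  fixes x :: "'m::real_normed_vector"
  assumes "x \<in> ball 0 R" "0 \<le> t" "t \<le> 1"
  shows "t *\<^sub>R x \<in> ball 0 R"
proof -
  have "norm (t *\<^sub>R x) \<le> norm x" using assms by (simp add: mult_left_le_one_le)
  then show ?thesis using assms(1) by simp
qed

lemma continuous_on_radial_integrand:
  fixes F :: "'m::real_normed_vector \<Rightarrow> real"
  assumes "continuous_on (ball 0 R) F"
  shows "continuous_on (ball 0 R \<times> {0..1}) (\<lambda>(x, t). t ^ m * F (t *\<^sub>R x))"
  unfolding split_beta
  by (intro continuous_intros continuous_on_compose2[OF assms])
    (auto intro: scaleR_in_ball_0 simp del: mem_ball)

lemma continuous_on_radial_line:
  fixes F :: "'m::real_normed_vector \<Rightarrow> real"
  assumes "continuous_on (ball 0 R) F" "x \<in> ball 0 R"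
  shows "continuous_on {0..1} (\<lambda>t. t ^ m * F (t *\<^sub>R x))"
  by (intro continuous_intros continuous_on_compose2[OF assms(1)])
    (use assms(2) in \<open>auto intro: scaleR_in_ball_0 simp del: mem_ball\<close>)

lemma continuous_on_radial_mean:
  fixes F :: "'m::real_normed_vector \<Rightarrow> real"
  assumes "continuous_on (ball 0 R) F"
  shows "continuous_on (ball 0 R) (radial_mean m F)"
  unfolding radial_mean_def
  using integral_continuous_on_param[of "ball 0 R" 0 1 "\<lambda>x t. t ^ m * F (t *\<^sub>R x)"]
    continuous_on_radial_integrand[OF assms] by (simp add: cbox_interval)

text \<open>
  Differentiation under the integral sign. By the mean value theorem, the error
  \<open>F(t y) - F(t x) - t F'(t x) (y - x)\<close> is a combination of increments of the partial derivatives between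
  \<open>t x\<close> and points \<open>t z\<close> with \<open>z\<close> on the segment from \<open>x\<close> to \<open>y\<close>; compactness of \<open>[0, 1]\<close> bounds these
  increments uniformly in \<open>t\<close>, so that the bound survives integration.
\<close>
lemma radial_mean_has_derivative:
  fixes F :: "'m::real_inner \<Rightarrow> real"
  assumes C: "parseval_frame (C :: 'm set)" and F: "Ck_on 1 (ball 0 R) F" and x: "x \<in> ball 0 R"
  shows "(radial_mean m F has_derivative
    (\<lambda>v. radial_mean (Suc m) (\<lambda>z. frechet_derivative F (at z) v) x)) (at x)"
proof -
  let ?B = "ball (0::'m) R"
  define F' where "F' z = frechet_derivative F (at z)" for z
  have dF: "(F has_derivative F' z) (at z)" if "z \<in> ?B" for z
    unfolding F'_def by (rule Ck_on_SucD(1)[of 0 ?B]) (use F that in auto)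
  have cF': "continuous_on ?B (\<lambda>z. F' z v)" for v
    using F by (simp add: F'_def)
  have cF: "continuous_on ?B F"
    using Ck_on_Suc_imp[of 0 ?B F] F by simp
  have F'_sum: "F' z v = (\<Sum>b\<in>C. (v \<bullet> b) * F' z b)" if "z \<in> ?B" for z v
    using parseval_frame_linear[OF C has_derivative_linear[OF dF[OF that]], of v] by simp
  have finC: "finite C" and normC: "\<And>b. b \<in> C \<Longrightarrow> norm b = 1"
    using C by (auto simp: parseval_frame_def)
  define J where "J v = radial_mean (Suc m) (\<lambda>z. F' z v) x" for v
  have J_sum: "J v = (\<Sum>b\<in>C. (v \<bullet> b) * J b)" for v
  proof -
    have "J v = integral {0..1} (\<lambda>t. \<Sum>b\<in>C. (v \<bullet> b) * (t ^ Suc m * F' (t *\<^sub>R x) b))"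
      unfolding J_def radial_mean_def
    proof (rule integral_cong)
      fix t :: real assume "t \<in> {0..1}"
      then have "F' (t *\<^sub>R x) v = (\<Sum>b\<in>C. (v \<bullet> b) * F' (t *\<^sub>R x) b)"
        by (intro F'_sum scaleR_in_ball_0[OF x]) auto
      then show "t ^ Suc m * F' (t *\<^sub>R x) v = (\<Sum>b\<in>C. (v \<bullet> b) * (t ^ Suc m * F' (t *\<^sub>R x) b))"
        by (simp only: sum_distrib_left) (simp add: mult_ac)
    qed
    also have "\<dots> = (\<Sum>b\<in>C. integral {0..1} (\<lambda>t. (v \<bullet> b) * (t ^ Suc m * F' (t *\<^sub>R x) b)))"
      by (intro integral_sum finC integrable_continuous_interval continuous_on_mult_left
          continuous_on_radial_line[OF cF' x])
    also have "\<dots> = (\<Sum>b\<in>C. (v \<bullet> b) * J b)"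
      unfolding J_def radial_mean_def by simp
    finally show ?thesis .
  qed
  have J_lin: "bounded_linear J"
  proof -
    have "bounded_linear (\<lambda>v. \<Sum>b\<in>C. (v \<bullet> b) * J b)"
      by (intro bounded_linear_sum bounded_linear_mult_const bounded_linear_inner_left)
    then show ?thesis by (simp only: J_sum[symmetric])
  qed
  have "\<exists>d>0. \<forall>y. norm (y - x) < d \<longrightarrow>
      norm (radial_mean m F y - radial_mean m F x - J (y - x)) \<le> e * norm (y - x)"
    if "e > 0" for e
  proof -
    \<comment> \<open>each vector of the frame contributes one increment to the error\<close>
    define e' where "e' = e / (card C + 1)"
    have e': "e' > 0" "card C * e' \<le> e" using that by (auto simp: e'_def field_simps)
    have "\<exists>X. open X \<and> x \<in> X \<and>
        (\<forall>z\<in>X \<inter> ?B. \<forall>t\<in>{0..1}. dist (F' (t *\<^sub>R z) b) (F' (t *\<^sub>R x) b) \<le> e')" if "b \<in> C" for b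
    proof -
      have "continuous_on (?B \<times> {0..1}) (\<lambda>(z, t). F' (t *\<^sub>R z) b)"
        using continuous_on_radial_integrand[OF cF', of 0 b] by simp
      from continuous_on_prod_compactE[OF this compact_Icc x e'(1)] show ?thesis
        by (metis (no_types, lifting) case_prod_conv)
    qed
    then obtain X where X: "\<And>b. b \<in> C \<Longrightarrow> open (X b) \<and> x \<in> X b \<and>
        (\<forall>z\<in>X b \<inter> ?B. \<forall>t\<in>{0..1}. dist (F' (t *\<^sub>R z) b) (F' (t *\<^sub>R x) b) \<le> e')"
      by metis
    have "open (?B \<inter> (\<Inter>b\<in>C. X b))" "x \<in> ?B \<inter> (\<Inter>b\<in>C. X b)"
      using X x finC by auto
    then obtain d where d: "d > 0" "ball x d \<subseteq> ?B \<inter> (\<Inter>b\<in>C. X b)"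
      using open_contains_ball by metis
    show ?thesis
    proof (intro exI[of _ d] conjI allI impI d(1))
      fix y assume "norm (y - x) < d"
      define u where "u = y - x"
      have xu: "x + s *\<^sub>R u \<in> ball x d" if "s \<in> {0..1}" for s
      proof -
        have "norm (s *\<^sub>R u) \<le> norm u" using that by (simp add: mult_left_le_one_le)
        then show ?thesis using \<open>norm (y - x) < d\<close> by (simp add: u_def dist_norm)
      qed
      have y: "y \<in> ?B" using xu[of 1] d(2) by (auto simp: u_def)
      have pw: "norm (t ^ m * (F (t *\<^sub>R y) - F (t *\<^sub>R x) - t * F' (t *\<^sub>R x) u)) \<le> e * norm u"
        if t: "t \<in> {0..1}" for t
      proof -
        \<comment> \<open>the error as the total increment of a function of one variable\<close>
        define k where "k s = F (t *\<^sub>R (x + s *\<^sub>R u)) - s * (t * F' (t *\<^sub>R x) u)" for s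
        have in_B: "t *\<^sub>R (x + s *\<^sub>R u) \<in> ?B" if "s \<in> {0..1}" for s
        proof (rule scaleR_in_ball_0)
          show "x + s *\<^sub>R u \<in> ?B" using xu[OF that] d(2) by blast
        qed (use t in auto)
        have dk: "(k has_derivative (\<lambda>h. F' (t *\<^sub>R (x + s *\<^sub>R u)) (t *\<^sub>R (h *\<^sub>R u)) - h * (t * F' (t *\<^sub>R x) u)))
            (at s within {0..1})" if s: "0 \<le> s" "s \<le> 1" for s
          unfolding k_def
          by (rule has_derivative_diff has_derivative_compose[of "\<lambda>s. t *\<^sub>R (x + s *\<^sub>R u)" _ _ _ F, OF _ dF]
              | rule derivative_eq_intros in_B refl | use s in simp)+
        obtain s where s: "s \<in> {0<..<1}" and
          "k 1 - k 0 = F' (t *\<^sub>R (x + s *\<^sub>R u)) (t *\<^sub>R ((1 - 0) *\<^sub>R u)) - (1 - 0) * (t * F' (t *\<^sub>R x) u)"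
          using mvt_simple[OF zero_less_one dk] by blast
        then have "F (t *\<^sub>R y) - F (t *\<^sub>R x) - t * F' (t *\<^sub>R x) u
            = F' (t *\<^sub>R (x + s *\<^sub>R u)) (t *\<^sub>R u) - t * F' (t *\<^sub>R x) u"
          by (simp add: k_def u_def)
        also have "F' (t *\<^sub>R (x + s *\<^sub>R u)) (t *\<^sub>R u) = t * F' (t *\<^sub>R (x + s *\<^sub>R u)) u"
          using linear_scale[OF has_derivative_linear[OF dF[OF in_B[of s]]], of t u] s by simp
        also have "\<dots> - t * F' (t *\<^sub>R x) u =
            t * (\<Sum>b\<in>C. (u \<bullet> b) * (F' (t *\<^sub>R (x + s *\<^sub>R u)) b - F' (t *\<^sub>R x) b))"
          using F'_sum[OF in_B[of s], of u] F'_sum[OF scaleR_in_ball_0[OF x, of t], of u] s t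
          by (simp add: right_diff_distrib sum_subtractf)
        finally have eq: "F (t *\<^sub>R y) - F (t *\<^sub>R x) - t * F' (t *\<^sub>R x) u =
            t * (\<Sum>b\<in>C. (u \<bullet> b) * (F' (t *\<^sub>R (x + s *\<^sub>R u)) b - F' (t *\<^sub>R x) b))" .
        have "\<bar>(u \<bullet> b) * (F' (t *\<^sub>R (x + s *\<^sub>R u)) b - F' (t *\<^sub>R x) b)\<bar> \<le> norm u * e'" if b: "b \<in> C" for b
        proof -
          have "x + s *\<^sub>R u \<in> X b \<inter> ?B" using xu[of s] s d(2) b by auto
          then have "\<bar>F' (t *\<^sub>R (x + s *\<^sub>R u)) b - F' (t *\<^sub>R x) b\<bar> \<le> e'"
            using X[OF b] t by (simp add: dist_real_def)
          moreover have "\<bar>u \<bullet> b\<bar> \<le> norm u"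
            using Cauchy_Schwarz_ineq2[of u b] normC[OF b] by simp
          ultimately show ?thesis by (simp add: abs_mult mult_mono)
        qed
        then have "\<bar>\<Sum>b\<in>C. (u \<bullet> b) * (F' (t *\<^sub>R (x + s *\<^sub>R u)) b - F' (t *\<^sub>R x) b)\<bar> \<le> card C * (norm u * e')"
          by (intro order_trans[OF sum_abs] sum_bounded_above) auto
        also have "\<dots> \<le> e * norm u"
          using mult_right_mono[OF e'(2), of "norm u"] by (simp add: mult_ac)
        finally have S: "\<bar>\<Sum>b\<in>C. (u \<bullet> b) * (F' (t *\<^sub>R (x + s *\<^sub>R u)) b - F' (t *\<^sub>R x) b)\<bar> \<le> e * norm u" .
        have "\<bar>t ^ m * t\<bar> \<le> 1" using t by (simp add: abs_mult power_abs mult_le_one power_le_one)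
        from mult_mono[OF this S] show ?thesis
          unfolding eq by (simp add: abs_mult mult_ac)
      qed
      have "radial_mean m F y - radial_mean m F x - J u =
          integral {0..1} (\<lambda>t. t ^ m * (F (t *\<^sub>R y) - F (t *\<^sub>R x) - t * F' (t *\<^sub>R x) u))"
      proof -
        have i: "(\<lambda>t. t ^ m * F (t *\<^sub>R y)) integrable_on {0..1}"
          "(\<lambda>t. t ^ m * F (t *\<^sub>R x)) integrable_on {0..1}"
          "(\<lambda>t. t ^ Suc m * F' (t *\<^sub>R x) u) integrable_on {0..1}"
          by (intro integrable_continuous_interval continuous_on_radial_line[OF _ x] continuous_on_radial_line[OF _ y] cF cF')+
        show ?thesis
          unfolding radial_mean_def J_def
          using integral_diff[OF integrable_diff[OF i(1,2)] i(3)] integral_diff[OF i(1,2)]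
          by (simp add: algebra_simps)
      qed
      moreover have "norm (integral {0..1} (\<lambda>t. t ^ m * (F (t *\<^sub>R y) - F (t *\<^sub>R x) - t * F' (t *\<^sub>R x) u)))
          \<le> (e * norm u) * (1 - 0)"
      proof (rule integral_bound[OF _ _ pw])
        have "continuous_on {0..1} (\<lambda>t. t ^ m * F (t *\<^sub>R y) - t ^ m * F (t *\<^sub>R x) - t ^ Suc m * F' (t *\<^sub>R x) u)"
          by (intro continuous_on_diff continuous_on_radial_line[OF _ x] continuous_on_radial_line[OF _ y] cF cF')
        then show "continuous_on {0..1} (\<lambda>t. t ^ m * (F (t *\<^sub>R y) - F (t *\<^sub>R x) - t * F' (t *\<^sub>R x) u))"
          by (simp add: algebra_simps)
      qed auto
      ultimately show "norm (radial_mean m F y - radial_mean m F x - J (y - x)) \<le> e * norm (y - x)"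
        by (simp add: u_def)
    qed
  qed
  then have "(radial_mean m F has_derivative J) (at x)"
    using J_lin unfolding has_derivative_at_alt by blast
  then show ?thesis unfolding J_def F'_def by simp
qed

lemma Ck_on_radial_mean:
  fixes F :: "'m::real_inner \<Rightarrow> real"
  assumes C: "parseval_frame (C :: 'm set)" and "Ck_on k (ball 0 R) F"
  shows "Ck_on k (ball 0 R) (radial_mean m F)"
  using assms(2)
proof (induction k arbitrary: m F)
  case 0
  then show ?case by (simp add: continuous_on_radial_mean)
next
  case (Suc k)
  have "Ck_on (Suc 0) (ball 0 R) F"
    using Suc.prems
  proof (induction k)
    case (Suc k) then show ?case using Ck_on_Suc_imp by blast
  qed
  then show ?case
    using Suc by (intro Ck_on_SucI[OF open_ball radial_mean_has_derivative[OF C]]) auto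
qed

lemma smooth_on_frechet_derivative:
  "smooth_on S F \<Longrightarrow> smooth_on S (\<lambda>x. frechet_derivative F (at x) v)"
  unfolding smooth_on_def using Ck_on_SucD(2) by blast

lemma smooth_on_has_derivative:
  "smooth_on S F \<Longrightarrow> x \<in> S \<Longrightarrow> (F has_derivative frechet_derivative F (at x)) (at x)"
  unfolding smooth_on_def using Ck_on_SucD(1) by blast

text \<open>
  This is the fundamental theorem of calculus along the ray \<open>t \<mapsto> t x\<close>.
\<close>
lemma hadamard_at_0:
  fixes F :: "'m::real_inner \<Rightarrow> real"
  assumes C: "parseval_frame (C :: 'm set)" and F: "smooth_on (ball 0 R) F" and x: "x \<in> ball 0 R"
  shows "F x = F 0 + (\<Sum>b\<in>C. (x \<bullet> b) * radial_mean 0 (\<lambda>z. frechet_derivative F (at z) b) x)"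
proof -
  let ?F' = "\<lambda>z. frechet_derivative F (at z)"
  have dF: "(F has_derivative ?F' (t *\<^sub>R x)) (at (t *\<^sub>R x))" if "t \<in> {0..1}" for t
    using smooth_on_has_derivative[OF F scaleR_in_ball_0[OF x]] that by simp
  have "((\<lambda>t. F (t *\<^sub>R x)) has_vector_derivative ?F' (t *\<^sub>R x) x) (at t within {0..1})"
    if "t \<in> {0..1}" for t
    unfolding has_vector_derivative_def
    using has_derivative_compose[of "\<lambda>t. t *\<^sub>R x" "\<lambda>h. h *\<^sub>R x" t "{0..1}" F, OF _ dF[OF that]]
      linear_scale[OF has_derivative_linear[OF dF[OF that]]]
    by (simp add: has_derivative_scaleR_left)
  then have "((\<lambda>t. ?F' (t *\<^sub>R x) x) has_integral (F x - F 0)) {0..1}"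
    using fundamental_theorem_of_calculus[of 0 1 "\<lambda>t. F (t *\<^sub>R x)"] by simp
  then have "F x - F 0 = integral {0..1} (\<lambda>t. ?F' (t *\<^sub>R x) x)"
    by (simp add: integral_unique)
  also have "\<dots> = integral {0..1} (\<lambda>t. \<Sum>b\<in>C. (x \<bullet> b) * (t ^ 0 * ?F' (t *\<^sub>R x) b))"
    by (rule integral_cong, subst parseval_frame_linear[OF C has_derivative_linear[OF dF]]) auto
  also have "\<dots> = (\<Sum>b\<in>C. integral {0..1} (\<lambda>t. (x \<bullet> b) * (t ^ 0 * ?F' (t *\<^sub>R x) b)))"
  proof (intro integral_sum integrable_continuous_interval continuous_on_mult_left
      continuous_on_radial_line[OF _ x])
    show "finite C" using C by (simp add: parseval_frame_def)
    show "continuous_on (ball 0 R) (\<lambda>z. ?F' z b)" for b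
      using smooth_on_frechet_derivative[OF F, of b] unfolding smooth_on_def by (metis Ck_on.simps(1))
  qed
  also have "\<dots> = (\<Sum>b\<in>C. (x \<bullet> b) * radial_mean 0 (\<lambda>z. ?F' z b) x)"
    unfolding radial_mean_def by simp
  finally show ?thesis by simp
qed

lemma hadamard:
  fixes F :: "'m::real_inner \<Rightarrow> real"
  assumes C: "parseval_frame (C :: 'm set)" and F: "smooth_on (ball p R) F" and R: "R > 0"
  obtains h where "\<And>b. smooth_on (ball p R) (h b)"
    "\<And>b. h b p = frechet_derivative F (at p) b"
    "\<And>x. x \<in> ball p R \<Longrightarrow> F x = F p + (\<Sum>b\<in>C. ((x - p) \<bullet> b) * h b x)"
proof -
  define G where "G y = F (y + p)" for y
  have "(\<lambda>y. y + p) ` ball 0 R \<subseteq> ball p R" by (auto simp: dist_norm)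
  then have G: "smooth_on (ball 0 R) G"
    unfolding smooth_on_def G_def
    using F unfolding smooth_on_def
    by (intro allI Ck_on_compose_affine[OF open_ball bounded_linear_ident]) blast+
  have dG: "frechet_derivative G (at 0) = frechet_derivative F (at p)"
  proof (rule frechet_derivative_at[symmetric])
    have "((\<lambda>y. y + p) has_derivative (\<lambda>v. v)) (at 0)" by (intro has_derivative_add_const has_derivative_ident)
    moreover have "(F has_derivative frechet_derivative F (at p)) (at (0 + p))"
      using smooth_on_has_derivative[OF F, of p] R by simp
    ultimately show "(G has_derivative frechet_derivative F (at p)) (at 0)"
      unfolding G_def by (rule has_derivative_compose)
  qed
  define H where "H b = radial_mean 0 (\<lambda>z. frechet_derivative G (at z) b)" for b
  show ?thesis
  proof (rule that[of "\<lambda>b x. H b (x + - p)"])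
    have H: "Ck_on k (ball 0 R) (H b)" for k b
      unfolding H_def using smooth_on_frechet_derivative[OF G] 
      by (intro Ck_on_radial_mean[OF C]) (simp add: smooth_on_def)
    show "smooth_on (ball p R) (\<lambda>x. H b (x + - p))" for b
      unfolding smooth_on_def
    proof (intro allI Ck_on_compose_affine[OF open_ball bounded_linear_ident _ H])
      show "(\<lambda>x. x + - p) ` ball p R \<subseteq> ball 0 R" by (auto simp: dist_norm norm_minus_commute)
    qed
    show "H b (p + - p) = frechet_derivative F (at p) b" for b
      unfolding H_def radial_mean_def by (simp add: dG)
    show "F x = F p + (\<Sum>b\<in>C. ((x - p) \<bullet> b) * H b (x + - p))" if "x \<in> ball p R" for x
      using hadamard_at_0[OF C G, of "x - p"] that
      by (simp add: H_def G_def dist_norm norm_minus_commute)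
  qed
qed

section \<open>Smooth functions and tangent vectors on a manifold\<close>

lemma smooth_on_cong:
  "open S \<Longrightarrow> (\<And>x. x \<in> S \<Longrightarrow> f x = g x) \<Longrightarrow> smooth_on S f \<Longrightarrow> smooth_on S g"
  unfolding smooth_on_def using Ck_on_cong by blast

lemma smooth_on_subset: "smooth_on S f \<Longrightarrow> T \<subseteq> S \<Longrightarrow> smooth_on T f"
  unfolding smooth_on_def using Ck_on_subset by blast

lemma smooth_on_local:
  "(\<And>x. x \<in> S \<Longrightarrow> \<exists>T. open T \<and> x \<in> T \<and> smooth_on T f) \<Longrightarrow> smooth_on S f"
  unfolding smooth_on_def by (meson Ck_on_local)

lemma smooth_on_const: "smooth_on S (\<lambda>x. c)"
  unfolding smooth_on_def by (simp add: Ck_on_const)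

lemma smooth_on_add:
  "open S \<Longrightarrow> smooth_on S f \<Longrightarrow> smooth_on S h \<Longrightarrow> smooth_on S (\<lambda>x. f x + h x)"
  unfolding smooth_on_def by (simp add: Ck_on_add)

lemma smooth_on_mult:
  fixes f h :: "'a::real_normed_vector \<Rightarrow> real"
  shows "open S \<Longrightarrow> smooth_on S f \<Longrightarrow> smooth_on S h \<Longrightarrow> smooth_on S (\<lambda>x. f x * h x)"
  unfolding smooth_on_def using Ck_on_scaleR[of S _ f h] by simp

lemma smooth_on_compose:
  fixes f :: "'m::real_inner \<Rightarrow> 'c::real_normed_vector"
  assumes "parseval_frame (C :: 'm set)" "open S" "h ` S \<subseteq> T" "smooth_on T f" "smooth_on S h"
  shows "smooth_on S (\<lambda>x. f (h x))"
  using assms unfolding smooth_on_def by (blast intro: Ck_on_compose)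

lemma smooth_on_compose_affine:
  assumes "open S" "bounded_linear L" "(\<lambda>x. L x + c) ` S \<subseteq> T" "smooth_on T f"
  shows "smooth_on S (\<lambda>x. f (L x + c))"
  using assms unfolding smooth_on_def by (blast intro: Ck_on_compose_affine)

lemma bounded_linear_Pair_0: "bounded_linear (\<lambda>x. (0, x))" "bounded_linear (\<lambda>x. (x, 0))"
  by (intro bounded_linear_Pair bounded_linear_zero bounded_linear_ident)+

context smooth_manifold
begin

lemma model_frame: obtains C where "parseval_frame (C :: 'b set)"
  using finite_dimensional parseval_frame_exists by blast

lemma chart_props:
  assumes "(U, \<phi>) \<in> M"
  shows "open U" "open (\<phi> ` U)" "continuous_on U \<phi>" "continuous_on (\<phi> ` U) (inv_into U \<phi>)"
    "q \<in> U \<Longrightarrow> inv_into U \<phi> (\<phi> q) = q" "y \<in> \<phi> ` U \<Longrightarrow> inv_into U \<phi> y \<in> U"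
    "y \<in> \<phi> ` U \<Longrightarrow> \<phi> (inv_into U \<phi> y) = y" "inj_on \<phi> U"
  using chart[OF assms] by (auto simp: homeomorphism_def inv_into_into f_inv_into_f intro: inj_on_inverseI)

lemma open_chart_image:
  assumes c: "(U, \<phi>) \<in> M" and "open W"
  shows "open (\<phi> ` (U \<inter> W))"
proof -
  have "\<phi> ` (U \<inter> W) = \<phi> ` U \<inter> inv_into U \<phi> -` W"
    using chart_props(5)[OF c] by auto
  then show ?thesis
    using continuous_open_preimage[OF chart_props(4,2)[OF c] assms(2)] by simp
qed

lemma chart_at: obtains U \<phi> where "(U, \<phi>) \<in> M" "p \<in> U"
  using cover[of p] by auto

lemma smooth_functions_const: "(\<lambda>q. c) \<in> smooth_functions M"
  by (auto simp: smooth_functions_def o_def smooth_on_const)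

lemma smooth_functions_add: "f \<in> smooth_functions M \<Longrightarrow> h \<in> smooth_functions M \<Longrightarrow> f + h \<in> smooth_functions M"
  unfolding smooth_functions_def by (auto simp: o_def intro!: smooth_on_add dest: chart_props(2))

lemma smooth_functions_mult: "f \<in> smooth_functions M \<Longrightarrow> h \<in> smooth_functions M \<Longrightarrow> f * h \<in> smooth_functions M"
  unfolding smooth_functions_def by (auto simp: o_def intro!: smooth_on_mult dest: chart_props(2))

lemma smooth_functions_scaleR: "f \<in> smooth_functions M \<Longrightarrow> r *\<^sub>R f \<in> smooth_functions M"
  using smooth_functions_mult[OF smooth_functions_const, of f r]
  by (simp add: times_fun_def scaleR_fun_def)

lemma smooth_functions_sum:
  "(\<And>i. i \<in> I \<Longrightarrow> f i \<in> smooth_functions M) \<Longrightarrow> (\<Sum>i\<in>I. f i) \<in> smooth_functions M"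
proof (induction I rule: infinite_finite_induct)
qed (use smooth_functions_const[of 0] in \<open>auto simp: zero_fun_def intro: smooth_functions_add\<close>)

text \<open>
  The extension is smooth near each point of the chart domain whose coordinates lie in \<open>S\<close>. All other
  points lie outside the preimage of \<open>K\<close> under the chart, which is compact, hence closed as the manifold
  is Hausdorff; so they have a neighbourhood on which the extension vanishes.
\<close>
lemma extend_by_zero_smooth:
  fixes F :: "'b \<Rightarrow> real"
  assumes c: "(U, \<phi>) \<in> M" and S: "open S" "S \<subseteq> \<phi> ` U" and K: "compact K" "K \<subseteq> S"
    and F: "smooth_on S F" "\<And>x. x \<notin> K \<Longrightarrow> F x = 0"
  shows "(\<lambda>q. if q \<in> U then F (\<phi> q) else 0) \<in> smooth_functions M" (is "?G \<in> _")
proof -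
  obtain C where C: "parseval_frame (C :: 'b set)" by (rule model_frame)
  have "smooth_on (\<psi> ` V) (?G \<circ> inv_into V \<psi>)" if c': "(V, \<psi>) \<in> M" for V \<psi>
  proof (rule smooth_on_local)
    fix y assume y: "y \<in> \<psi> ` V"
    define q where "q = inv_into V \<psi> y"
    have q: "q \<in> V" "\<psi> q = y" using chart_props(6,7)[OF c' y] by (auto simp: q_def)
    let ?W = "U \<inter> \<phi> -` S" and ?K = "inv_into U \<phi> ` K"
    show "\<exists>T. open T \<and> y \<in> T \<and> smooth_on T (?G \<circ> inv_into V \<psi>)"
    proof (cases "q \<in> ?W")
      case True
      have "open ?W" by (rule continuous_open_preimage[OF chart_props(3,1)[OF c] S(1)])
      then have T: "open (\<psi> ` (V \<inter> ?W))" by (rule open_chart_image[OF c'])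
      have "smooth_on (\<psi> ` (V \<inter> ?W)) (\<lambda>y. F ((\<phi> \<circ> inv_into V \<psi>) y))"
      proof (rule smooth_on_compose[OF C T _ F(1)])
        show "(\<phi> \<circ> inv_into V \<psi>) ` \<psi> ` (V \<inter> ?W) \<subseteq> S"
          using chart_props(5)[OF c'] by auto
        show "smooth_on (\<psi> ` (V \<inter> ?W)) (\<phi> \<circ> inv_into V \<psi>)"
          by (rule smooth_on_subset[OF compatible[OF c' c]]) auto
      qed
      then have "smooth_on (\<psi> ` (V \<inter> ?W)) (?G \<circ> inv_into V \<psi>)"
        by (rule smooth_on_cong[OF T, rotated]) (use chart_props(5)[OF c'] in auto)
      then show ?thesis using T True q by blast
    next
      case False
      have "continuous_on K (inv_into U \<phi>)"
        using continuous_on_subset[OF chart_props(4)[OF c]] K(2) S(2) by blast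
      then have "open (- ?K)"
        by (intro open_Compl compact_imp_closed compact_continuous_image K(1))
      then have T: "open (\<psi> ` (V \<inter> - ?K))" by (rule open_chart_image[OF c'])
      have "q \<notin> ?K" using False K(2) S(2) chart_props(6,7)[OF c] by (auto simp: subset_iff)
      have zero: "?G r = 0" if "r \<notin> ?K" for r
        using that F(2) chart_props(5)[OF c] by (metis image_eqI)
      have "smooth_on (\<psi> ` (V \<inter> - ?K)) (?G \<circ> inv_into V \<psi>)"
      proof (intro smooth_on_cong[OF T _ smooth_on_const[of _ 0]])
        fix y' assume "y' \<in> \<psi> ` (V \<inter> - ?K)"
        then obtain r where "r \<notin> ?K" "r \<in> V" "y' = \<psi> r" by blast
        then show "0 = (?G \<circ> inv_into V \<psi>) y'" using zero[of r] chart_props(5)[OF c'] by (auto split: if_splits)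
      qed
      then show ?thesis using T q \<open>q \<notin> ?K\<close> by blast
    qed
  qed
  then show ?thesis by (auto simp: smooth_functions_def)
qed

lemma tangent_add: "v \<in> tangent_space M p \<Longrightarrow> f \<in> smooth_functions M \<Longrightarrow> h \<in> smooth_functions M \<Longrightarrow>
    v (f + h) = v f + v h"
  and tangent_scaleR: "v \<in> tangent_space M p \<Longrightarrow> f \<in> smooth_functions M \<Longrightarrow> v (r *\<^sub>R f) = r * v f"
  and tangent_mult: "v \<in> tangent_space M p \<Longrightarrow> f \<in> smooth_functions M \<Longrightarrow> h \<in> smooth_functions M \<Longrightarrow>
    v (f * h) = f p * v h + h p * v f"
  and tangent_nonsmooth: "v \<in> tangent_space M p \<Longrightarrow> f \<notin> smooth_functions M \<Longrightarrow> v f = 0"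
  unfolding tangent_space_def by blast+

lemma tangent_const:
  assumes "v \<in> tangent_space M p"
  shows "v (\<lambda>q. c) = 0"
proof -
  have 1: "(\<lambda>q. 1) \<in> smooth_functions M" by (rule smooth_functions_const)
  have "v ((\<lambda>q. 1) * (\<lambda>q. 1)) = 1 * v (\<lambda>q. 1) + 1 * v (\<lambda>q. 1)" by (rule tangent_mult[OF assms 1 1])
  then have "v (\<lambda>q. 1) = 0" by (simp add: times_fun_def)
  then show ?thesis using tangent_scaleR[OF assms 1, of c] by (simp add: scaleR_fun_def)
qed

lemma tangent_sum:
  assumes "v \<in> tangent_space M p" "\<And>i. i \<in> I \<Longrightarrow> f i \<in> smooth_functions M"
  shows "v (\<Sum>i\<in>I. f i) = (\<Sum>i\<in>I. v (f i))"
  using assms(2)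
  by (induction I rule: infinite_finite_induct)
    (use tangent_const[OF assms(1), of 0] in
      \<open>auto simp: zero_fun_def tangent_add[OF assms(1)] smooth_functions_sum\<close>)

text \<open>
  Hadamard's lemma gives, in coordinates near \<open>p\<close>, \<open>f = f p + \<Sum>\<^sub>b (x - x\<^sub>0)\<^sub>b h\<^sub>b\<close> with \<open>h\<^sub>b p = \<partial>\<^sub>b f p\<close>.
  A derivation only sees globally defined functions. Multiplying by the square of a bump function \<open>B\<close> with
  \<open>B p = 1\<close> leaves one factor \<open>B\<close> for the coordinate and one for \<open>h\<^sub>b\<close>, so that both extend by zero and the
  identity becomes one between global smooth functions. Applying \<open>v\<close>, the terms with \<open>v B\<close> cancel and there
  remains \<open>v f = \<Sum>\<^sub>b v (B (x - x\<^sub>0)\<^sub>b) \<partial>\<^sub>b f p\<close>.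
\<close>
lemma tangent_is_directional_derivative:
  assumes c: "(U, \<phi>) \<in> M" and p: "p \<in> U" and v: "v \<in> tangent_space M p"
  obtains w where "\<And>f. f \<in> smooth_functions M \<Longrightarrow>
    v f = frechet_derivative (f \<circ> inv_into U \<phi>) (at (\<phi> p)) w"
proof -
  obtain C where C: "parseval_frame (C :: 'b set)" by (rule model_frame)
  define x0 where "x0 = \<phi> p"
  have "x0 \<in> \<phi> ` U" using p by (simp add: x0_def)
  then obtain R where R: "R > 0" "ball x0 R \<subseteq> \<phi> ` U"
    using chart_props(2)[OF c] open_contains_ball by metis
  let ?K = "cball x0 (R / 2)"
  have K: "compact ?K" "?K \<subseteq> ball x0 R"
    using compact_cball_parseval[OF C] R(1) by auto
  obtain \<beta> :: "'b \<Rightarrow> real" where \<beta>: "smooth_on UNIV \<beta>" "\<beta> x0 = 1" "\<And>x. x \<notin> ?K \<Longrightarrow> \<beta> x = 0"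
    using bump_function_exists[of "R / 2" x0] R(1) by auto
  define ext where "ext k q = (if q \<in> U then \<beta> (\<phi> q) * k (\<phi> q) else 0)" for k :: "'b \<Rightarrow> real" and q
  have ext: "ext k \<in> smooth_functions M" if "smooth_on (ball x0 R) k" for k
    unfolding ext_def
    by (rule extend_by_zero_smooth[OF c open_ball R(2) K])
      (use that \<beta> in \<open>auto intro!: smooth_on_mult elim: smooth_on_subset\<close>)
  have ext_p: "ext k p = k x0" for k using p \<beta>(2) by (simp add: ext_def flip: x0_def)
  define B where "B = ext (\<lambda>x. 1)"
  define X where "X b = ext (\<lambda>x. (x - x0) \<bullet> b)" for b
  have B: "B \<in> smooth_functions M" unfolding B_def by (intro ext smooth_on_const)
  have X: "X b \<in> smooth_functions M" for b
  proof -
    have "smooth_on (ball x0 R) (\<lambda>x. x \<bullet> b + - (x0 \<bullet> b))"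
      unfolding smooth_on_def by (intro allI Ck_on_affine[OF open_ball bounded_linear_inner_left])
    then show ?thesis unfolding X_def by (intro ext) (simp add: inner_diff_left)
  qed
  have Bp: "B p = 1" and Xp: "X b p = 0" for b by (auto simp: B_def X_def ext_p)
  show ?thesis
  proof (rule that[of "\<Sum>b\<in>C. v (X b) *\<^sub>R b"])
    fix f assume f: "f \<in> smooth_functions M"
    let ?F = "f \<circ> inv_into U \<phi>"
    have "smooth_on (\<phi> ` U) ?F" using f c by (auto simp: smooth_functions_def)
    then have F: "smooth_on (ball x0 R) ?F" using R(2) by (rule smooth_on_subset)
    obtain h where h: "\<And>b. smooth_on (ball x0 R) (h b)"
      "\<And>b. h b x0 = frechet_derivative ?F (at x0) b"
      "\<And>x. x \<in> ball x0 R \<Longrightarrow> ?F x = ?F x0 + (\<Sum>b\<in>C. ((x - x0) \<bullet> b) * h b x)"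
      using hadamard[OF C F R(1)] by blast
    define H where "H b = ext (h b)" for b
    have H: "H b \<in> smooth_functions M" for b unfolding H_def by (intro ext h)
    have "B * (B * f) = f p *\<^sub>R (B * B) + (\<Sum>b\<in>C. X b * H b)"
    proof
      fix q
      show "(B * (B * f)) q = (f p *\<^sub>R (B * B) + (\<Sum>b\<in>C. X b * H b)) q"
      proof (cases "q \<in> U \<and> \<phi> q \<in> ball x0 R")
        case True
        then have "f q = f p + (\<Sum>b\<in>C. ((\<phi> q - x0) \<bullet> b) * h b (\<phi> q))"
          using h(3)[of "\<phi> q"] chart_props(5)[OF c] p by (simp add: x0_def)
        then show ?thesis
          using True by (simp add: sum_fun_apply B_def X_def H_def ext_def algebra_simps sum_distrib_left)
      next
        case False
        then have "q \<notin> U \<or> \<beta> (\<phi> q) = 0" using \<beta>(3) K(2) by blast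
        then have "B q = 0" "\<And>b. X b q = 0" by (auto simp: B_def X_def ext_def)
        then show ?thesis by (simp add: sum_fun_apply)
      qed
    qed
    then have "v (B * (B * f)) = v (f p *\<^sub>R (B * B) + (\<Sum>b\<in>C. X b * H b))" by simp
    also have "\<dots> = f p * v (B * B) + (\<Sum>b\<in>C. v (X b * H b))"
      by (simp add: tangent_add[OF v] tangent_scaleR[OF v] tangent_sum[OF v] B X H
          smooth_functions_mult smooth_functions_scaleR smooth_functions_sum)
    also have "\<dots> = f p * (2 * v B) + (\<Sum>b\<in>C. h b x0 * v (X b))"
      by (simp add: tangent_mult[OF v] B X H Bp Xp H_def[symmetric] ext_p[of "h _", folded H_def])
    also have "v (B * (B * f)) = v f + 2 * (f p * v B)"
      by (simp add: tangent_mult[OF v] B f Bp smooth_functions_mult)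
    finally have "v f = (\<Sum>b\<in>C. v (X b) * frechet_derivative ?F (at x0) b)"
      by (simp add: h(2) mult.commute)
    also have "\<dots> = frechet_derivative ?F (at x0) (\<Sum>b\<in>C. v (X b) *\<^sub>R b)"
    proof -
      have L: "linear (frechet_derivative ?F (at x0))"
        using has_derivative_linear[OF smooth_on_has_derivative[OF F]] R(1) by simp
      show ?thesis by (simp add: linear_sum[OF L] linear_scale[OF L])
    qed
    finally show "v f = frechet_derivative ?F (at (\<phi> p)) (\<Sum>b\<in>C. v (X b) *\<^sub>R b)"
      by (simp add: x0_def)
  qed
qed

end

section \<open>Left-invariant extension of tangent vectors\<close>

context lie_group
begin

text \<open>
  Smoothness of the multiplication is given chart by chart in the target as well, hence the function is
  smooth on the open sets of pairs whose product lies in a given chart domain, and these cover everything.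
\<close>
lemma smooth_functions_mul_charts:
  assumes c: "(V, \<psi>) \<in> M" "(U, \<phi>) \<in> M" and f: "f \<in> smooth_functions M"
  shows "smooth_on (\<psi> ` V \<times> \<phi> ` U) (\<lambda>z. f (mul (inv_into V \<psi> (fst z)) (inv_into U \<phi> (snd z))))"
proof (rule smooth_on_local)
  let ?m = "\<lambda>(a, b). mul a b" and ?P = "map_prod \<psi> \<phi>"
  let ?i = "\<lambda>z. (inv_into V \<psi> (fst z), inv_into U \<phi> (snd z))"
  obtain C where C: "parseval_frame (C :: 'b set)" by (rule model_frame)
  fix z assume z: "z \<in> \<psi> ` V \<times> \<phi> ` U"
  obtain W \<omega> where w: "(W, \<omega>) \<in> M" "?m (?i z) \<in> W" by (rule chart_at)
  let ?T = "?P ` ((V \<times> U) \<inter> ?m -` W)"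
  have T_E: thesis if "y \<in> ?T" "\<And>r. r \<in> V \<times> U \<Longrightarrow> ?m r \<in> W \<Longrightarrow> y = ?P r \<Longrightarrow> thesis" for y thesis
    using that(1) by (rule imageE) (rule that(2), simp_all)
  have inv: "inv_into (V \<times> U) ?P (?P r) = r" if "r \<in> V \<times> U" for r
    by (rule inv_into_f_f[OF map_prod_inj_on[OF chart_props(8)[OF c(1)] chart_props(8)[OF c(2)]] that])
  have i: "?i (?P r) = r" if "r \<in> V \<times> U" for r
    using that chart_props(5)[OF c(1)] chart_props(5)[OF c(2)] by auto
  have ii: "?P (?i y) = y \<and> ?i y \<in> V \<times> U" if "y \<in> \<psi> ` V \<times> \<phi> ` U" for y
    using that chart_props(6,7)[OF c(1)] chart_props(6,7)[OF c(2)] by auto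
  have m: "continuous_on UNIV ?m"
    and sm: "smooth_on ?T (\<omega> \<circ> ?m \<circ> inv_into (V \<times> U) ?P)"
    using smooth_mul c w(1) unfolding smooth_map_def prod_atlas_def by blast+
  have T_eq: "?T = (\<psi> ` V \<times> \<phi> ` U) \<inter> (\<lambda>z. ?m (?i z)) -` W"
  proof
    show "?T \<subseteq> (\<psi> ` V \<times> \<phi> ` U) \<inter> (\<lambda>z. ?m (?i z)) -` W"
    proof (rule image_subsetI)
      fix r assume r: "r \<in> (V \<times> U) \<inter> ?m -` W"
      then have "?i (?P r) = r" using i by blast
      then show "?P r \<in> (\<psi> ` V \<times> \<phi> ` U) \<inter> (\<lambda>z. ?m (?i z)) -` W"
        using r by (auto simp: map_prod_def)
    qed
    show "(\<psi> ` V \<times> \<phi> ` U) \<inter> (\<lambda>z. ?m (?i z)) -` W \<subseteq> ?T"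
    proof
      fix y assume y: "y \<in> (\<psi> ` V \<times> \<phi> ` U) \<inter> (\<lambda>z. ?m (?i z)) -` W"
      then have "?i y \<in> (V \<times> U) \<inter> ?m -` W" "y = ?P (?i y)" using ii[of y] by auto
      then show "y \<in> ?T" by (rule rev_image_eqI)
    qed
  qed
  have "continuous_on (\<psi> ` V \<times> \<phi> ` U) ?i"
    by (intro continuous_on_Pair continuous_on_compose2[OF chart_props(4)[OF c(1)]]
        continuous_on_compose2[OF chart_props(4)[OF c(2)]] continuous_on_fst continuous_on_snd continuous_on_id) auto
  then have "continuous_on (\<psi> ` V \<times> \<phi> ` U) (\<lambda>z. ?m (?i z))"
    by (rule continuous_on_compose2[OF m]) auto
  then have T: "open ?T"
    unfolding T_eq
    by (rule continuous_open_preimage) (intro open_Times chart_props(2)[OF c(1)] chart_props(2)[OF c(2)] chart_props(1)[OF w(1)])+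
  define h where "h = \<omega> \<circ> ?m \<circ> inv_into (V \<times> U) ?P"
  define F where "F = f \<circ> inv_into W \<omega>"
  have h: "h (?P r) = \<omega> (?m r)" if "r \<in> V \<times> U" for r
    using inv[OF that] by (simp only: h_def comp_apply)
  have "smooth_on ?T (\<lambda>y. F (h y))"
  proof (rule smooth_on_compose[where f=F and h=h and T="\<omega> ` W", OF C T])
    show "h ` ?T \<subseteq> \<omega> ` W"
    proof (rule image_subsetI)
      fix y assume "y \<in> ?T"
      then obtain r where r: "r \<in> V \<times> U" "?m r \<in> W" "y = ?P r" by (rule T_E)
      show "h y \<in> \<omega> ` W" unfolding r(3) h[OF r(1)] using r(2) by (rule imageI)
    qed
    show "smooth_on (\<omega> ` W) F" using f w(1) by (auto simp: smooth_functions_def F_def)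
    show "smooth_on ?T h" unfolding h_def by (rule sm)
  qed
  then have "smooth_on ?T (\<lambda>z. f (mul (inv_into V \<psi> (fst z)) (inv_into U \<phi> (snd z))))"
  proof (rule smooth_on_cong[OF T, rotated])
    fix y assume "y \<in> ?T"
    then obtain r where r: "r \<in> V \<times> U" "?m r \<in> W" "y = ?P r" by (rule T_E)
    have "inv_into V \<psi> (fst y) = fst r" "inv_into U \<phi> (snd y) = snd r"
      using i[OF r(1)] unfolding r(3)[symmetric] by (metis fst_conv snd_conv)+
    then show "F (h y) = f (mul (inv_into V \<psi> (fst y)) (inv_into U \<phi> (snd y)))"
      using h[OF r(1)] chart_props(5)[OF w(1) r(2)] by (simp add: F_def split_beta r(3))
  qed
  moreover have "z \<in> ?T" unfolding T_eq by (intro IntI z vimageI2 w(2))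
  ultimately show "\<exists>T. open T \<and> z \<in> T \<and>
      smooth_on T (\<lambda>z. f (mul (inv_into V \<psi> (fst z)) (inv_into U \<phi> (snd z))))"
    using T by blast
qed

lemma smooth_functions_left_translate:
  assumes f: "f \<in> smooth_functions M"
  shows "f \<circ> mul a \<in> smooth_functions M"
proof -
  obtain V \<psi> where V: "(V, \<psi>) \<in> M" "a \<in> V" by (rule chart_at)
  have "smooth_on (\<phi> ` U) (f \<circ> mul a \<circ> inv_into U \<phi>)" if c: "(U, \<phi>) \<in> M" for U \<phi>
    using smooth_on_compose_affine[OF chart_props(2)[OF c] bounded_linear_Pair_0(1) _
        smooth_functions_mul_charts[OF V(1) c f], of "(\<psi> a, 0)"]
      V(2) chart_props(5)[OF V] by (simp add: o_def image_subset_iff)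
  then show ?thesis by (auto simp: smooth_functions_def)
qed

text \<open>
  With \<open>v\<close> the derivative in a direction \<open>w\<close> of a chart at the unit element, the function is in charts the
  derivative of \<open>(q, r) \<mapsto> f (q r)\<close> in the direction \<open>(0, w)\<close>, restricted to the slice where \<open>r\<close> is the unit.
\<close>
lemma smooth_functions_left_invariant_derivative:
  assumes v: "v \<in> tangent_space M one" and f: "f \<in> smooth_functions M"
  shows "(\<lambda>q. v (f \<circ> mul q)) \<in> smooth_functions M"
proof -
  obtain U \<phi> where U: "(U, \<phi>) \<in> M" "one \<in> U" by (rule chart_at)
  obtain w where w: "\<And>f. f \<in> smooth_functions M \<Longrightarrow>
      v f = frechet_derivative (f \<circ> inv_into U \<phi>) (at (\<phi> one)) w"
    using tangent_is_directional_derivative[OF U v] by blast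
  have "smooth_on (\<psi> ` V) ((\<lambda>q. v (f \<circ> mul q)) \<circ> inv_into V \<psi>)" if V: "(V, \<psi>) \<in> M" for V \<psi>
  proof -
    define \<Phi> where "\<Phi> z = f (mul (inv_into V \<psi> (fst z)) (inv_into U \<phi> (snd z)))" for z
    have \<Phi>: "smooth_on (\<psi> ` V \<times> \<phi> ` U) \<Phi>"
      unfolding \<Phi>_def by (rule smooth_functions_mul_charts[OF V U(1) f])
    have "smooth_on (\<psi> ` V) (\<lambda>y. frechet_derivative \<Phi> (at ((y, 0) + (0, \<phi> one))) (0, w))"
      by (rule smooth_on_compose_affine[OF chart_props(2)[OF V] bounded_linear_Pair_0(2) _
            smooth_on_frechet_derivative[OF \<Phi>]]) (use U in auto)
    then show ?thesis
    proof (rule smooth_on_cong[OF chart_props(2)[OF V], rotated])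
      fix y assume y: "y \<in> \<psi> ` V"
      have "((\<lambda>x. (y, x)) has_derivative (\<lambda>h. (0, h))) (at (\<phi> one))"
        by (auto intro!: derivative_eq_intros)
      moreover have "(\<Phi> has_derivative frechet_derivative \<Phi> (at (y, \<phi> one))) (at (y, \<phi> one))"
        using smooth_on_has_derivative[OF \<Phi>] y U(2) by blast
      ultimately have "((\<lambda>x. \<Phi> (y, x)) has_derivative (\<lambda>h. frechet_derivative \<Phi> (at (y, \<phi> one)) (0, h))) (at (\<phi> one))"
        by (rule has_derivative_compose)
      from frechet_derivative_at[OF this]
      show "frechet_derivative \<Phi> (at ((y, 0) + (0, \<phi> one))) (0, w) = ((\<lambda>q. v (f \<circ> mul q)) \<circ> inv_into V \<psi>) y"
        using w[OF smooth_functions_left_translate[OF f]]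
        by (simp add: \<Phi>_def o_def fun_eq_iff)
    qed
  qed
  then show ?thesis by (auto simp: smooth_functions_def)
qed

lemma pushforward_tangent:
  assumes v: "v \<in> tangent_space M p"
  shows "pushforward M (mul a) v \<in> tangent_space M (mul a p)"
proof -
  note lt = smooth_functions_left_translate[of _ a]
  have eq: "(f + h) \<circ> mul a = (f \<circ> mul a) + (h \<circ> mul a)" "(r *\<^sub>R f) \<circ> mul a = r *\<^sub>R (f \<circ> mul a)"
    "(f * h) \<circ> mul a = (f \<circ> mul a) * (h \<circ> mul a)" for f h :: "'g \<Rightarrow> real" and r
    by (auto simp: fun_eq_iff)
  show ?thesis
    unfolding tangent_space_def
    by (auto simp: pushforward_def eq tangent_add[OF v] tangent_mult[OF v] tangent_scaleR[OF v] lt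
        smooth_functions_add smooth_functions_mult smooth_functions_scaleR)
qed

lemma pushforward_mul:
  "pushforward M (mul a) (pushforward M (mul b) v) = pushforward M (mul (mul a b)) v"
proof -
  have "f \<circ> mul a \<circ> mul b = f \<circ> mul (mul a b)" for f :: "'g \<Rightarrow> real"
    by (simp add: fun_eq_iff assoc)
  then show ?thesis unfolding pushforward_def by (intro ext) (simp add: smooth_functions_left_translate del: comp_apply)
qed

lemma pushforward_one: "v \<in> tangent_space M p \<Longrightarrow> pushforward M (mul one) v = v"
  by (auto simp: pushforward_def o_def left_neutral tangent_nonsmooth fun_eq_iff)

text \<open>
  The vector is translated to the unit element and from there to all points of the group.
\<close>
lemma left_invariant_extension:
  assumes v: "v \<in> tangent_space M p"
  obtains X where "X \<in> left_invariant_fields M mul" "X p = v"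
proof
  define u where "u = pushforward M (mul (iv p)) v"
  define X where "X q = pushforward M (mul q) u" for q
  have u: "u \<in> tangent_space M one"
    using pushforward_tangent[OF v, of "iv p"] by (simp add: u_def left_inverse)
  have "X q \<in> tangent_space M q" for q
    using pushforward_tangent[OF u, of q] by (simp add: X_def right_neutral)
  moreover have "vf_apply X f \<in> smooth_functions M" if "f \<in> smooth_functions M" for f
    using smooth_functions_left_invariant_derivative[OF u that] that
    by (simp add: vf_apply_def X_def pushforward_def)
  ultimately have "X \<in> vector_fields M" by (simp add: vector_fields_def)
  then show "X \<in> left_invariant_fields M mul"
    by (simp add: left_invariant_fields_def X_def pushforward_mul)
  show "X p = v"
    by (simp add: X_def u_def pushforward_mul right_inverse pushforward_one[OF v])
qed

end

section \<open>Traces, Gram matrices and connections\<close>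

text \<open>
  The trace in terms of a family \<open>e\<close> with coordinate functionals \<open>\<theta>\<close>. Expanding the vectors of the chosen
  basis \<open>B\<close> by \<open>\<theta>\<close> turns the trace into a double sum, and summing over \<open>B\<close> first reassembles the
  vectors \<open>t i\<close>.
\<close>
lemma endo_trace_eq_sum:
  fixes e t :: "'i \<Rightarrow> 'v::real_vector" and \<theta> :: "'i \<Rightarrow> 'v \<Rightarrow> real"
  assumes I: "finite I" and V: "subspace V" and e: "\<And>i. i \<in> I \<Longrightarrow> e i \<in> V"
    and t: "\<And>i. i \<in> I \<Longrightarrow> t i \<in> V"
    and expand: "\<And>w. w \<in> V \<Longrightarrow> w = (\<Sum>i\<in>I. \<theta> i w *\<^sub>R e i)"
    and \<theta>_sum: "\<And>i (B::'v set) a. i \<in> I \<Longrightarrow> B \<subseteq> V \<Longrightarrow> finite B \<Longrightarrow>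
      \<theta> i (\<Sum>b\<in>B. a b *\<^sub>R b) = (\<Sum>b\<in>B. a b * \<theta> i b)"
    and T: "\<And>w. w \<in> V \<Longrightarrow> T w = (\<Sum>i\<in>I. \<theta> i w *\<^sub>R t i)"
  shows "endo_trace V T = (\<Sum>i\<in>I. \<theta> i (t i))"
proof -
  define B where "B = (SOME B. independent B \<and> span B = V)"
  have "\<exists>B. independent B \<and> span B = V"
    using maximal_independent_subset[of V] V by (metis span_minimal subset_antisym)
  then have B: "independent B" "span B = V"
    unfolding B_def by (metis (mono_tags, lifting) someI_ex)+
  have "V \<subseteq> span (e ` I)"
  proof
    fix w assume "w \<in> V"
    have "(\<Sum>i\<in>I. \<theta> i w *\<^sub>R e i) \<in> span (e ` I)"
      by (intro span_sum span_scale span_base) auto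
    then show "w \<in> span (e ` I)" using expand[OF \<open>w \<in> V\<close>] by simp
  qed
  then have fin: "finite B"
    using independent_span_bound[of "e ` I" B] I B span_superset[of B] by auto
  have BV: "B \<subseteq> V" using B(2) span_superset by auto
  have rep: "representation B (T b) b = (\<Sum>i\<in>I. \<theta> i b * representation B (t i) b)" if "b \<in> B" for b
  proof -
    have "representation B (T b) b = representation B (\<Sum>i\<in>I. \<theta> i b *\<^sub>R t i) b"
      using T BV that by auto
    also have "\<dots> = (\<Sum>i\<in>I. representation B (\<theta> i b *\<^sub>R t i) b)"
      by (rule fun_cong[OF representation_sum[OF B(1)], THEN trans])
        (use t B(2) subspace_scale[OF V] in \<open>auto simp: sum_fun_apply\<close>)
    also have "\<dots> = (\<Sum>i\<in>I. \<theta> i b * representation B (t i) b)"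
      by (intro sum.cong refl) (use t B in \<open>simp add: representation_scale\<close>)
    finally show ?thesis .
  qed
  have "endo_trace V T = (\<Sum>b\<in>B. representation B (T b) b)"
    unfolding endo_trace_def Let_def B_def ..
  also have "\<dots> = (\<Sum>b\<in>B. \<Sum>i\<in>I. representation B (t i) b * \<theta> i b)"
    by (intro sum.cong refl) (simp add: rep mult.commute)
  also have "\<dots> = (\<Sum>i\<in>I. \<Sum>b\<in>B. representation B (t i) b * \<theta> i b)"
    by (rule sum.swap)
  also have "\<dots> = (\<Sum>i\<in>I. \<theta> i (\<Sum>b\<in>B. representation B (t i) b *\<^sub>R b))"
    by (intro sum.cong refl) (simp add: \<theta>_sum[OF _ BV fin])
  also have "\<dots> = (\<Sum>i\<in>I. \<theta> i (t i))"
    by (intro sum.cong refl arg_cong[where f="\<theta> _"] sum_representation_eq[OF B(1) _ fin])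
      (use t B(2) in auto)
  finally show ?thesis .
qed

text \<open>
  The usual \<open>h = h (b h') = (h b) h' = h'\<close> for matrices. Applied to the Gram matrices of a frame at two
  points it compares the dual metrics at these points, applied to \<open>h\<close> and its transpose it gives symmetry.
\<close>
lemma inverse_gram_unique:
  assumes I: "finite I" and h: "inverse_gram I e b h" and h': "inverse_gram I e' b' h'"
    and eq: "\<And>i j. i \<in> I \<Longrightarrow> j \<in> I \<Longrightarrow> b (e i) (e j) = b' (e' i) (e' j)"
    and i: "i \<in> I" and j: "j \<in> I"
  shows "h i j = h' i j"
proof -
  have "h i j = (\<Sum>k\<in>I. h i k * (\<Sum>l\<in>I. b' (e' k) (e' l) * h' l j))"
  proof -
    have "(\<Sum>k\<in>I. h i k * (\<Sum>l\<in>I. b' (e' k) (e' l) * h' l j)) = (\<Sum>k\<in>I. h i k * (if k = j then 1 else 0))"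
      using h' j unfolding inverse_gram_def by (intro sum.cong refl) simp
    also have "\<dots> = h i j" using I j by (simp add: if_distrib cong: if_cong)
    finally show ?thesis ..
  qed
  also have "\<dots> = (\<Sum>k\<in>I. \<Sum>l\<in>I. h i k * b (e k) (e l) * h' l j)"
    unfolding sum_distrib_left using eq by (intro sum.cong refl) simp
  also have "\<dots> = (\<Sum>l\<in>I. \<Sum>k\<in>I. h i k * b (e k) (e l) * h' l j)"
    by (rule sum.swap)
  also have "\<dots> = (\<Sum>l\<in>I. (\<Sum>k\<in>I. h i k * b (e k) (e l)) * h' l j)"
    by (simp add: sum_distrib_right)
  also have "\<dots> = (\<Sum>l\<in>I. (if i = l then 1 else 0) * h' l j)"
    using h i unfolding inverse_gram_def by (intro sum.cong refl) simp
  also have "\<dots> = (\<Sum>l\<in>I. if i = l then h' l j else 0)"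
    by (intro sum.cong refl) simp
  also have "\<dots> = h' i j" using I i by simp
  finally show ?thesis .
qed

context smooth_manifold
begin

lemma vector_fields_tangent: "X \<in> vector_fields M \<Longrightarrow> X p \<in> tangent_space M p"
  by (simp add: vector_fields_def)

lemma vector_fields_apply: "X \<in> vector_fields M \<Longrightarrow> f \<in> smooth_functions M \<Longrightarrow> (\<lambda>p. X p f) \<in> smooth_functions M"
  by (simp add: vector_fields_def vf_apply_def)

lemma vector_fields_zero: "0 \<in> vector_fields M"
  using subspace_0[OF subspace_tangent_space] smooth_functions_const[of 0]
  by (auto simp: vector_fields_def vf_apply_def)

lemma vector_fields_add: "X \<in> vector_fields M \<Longrightarrow> Y \<in> vector_fields M \<Longrightarrow> X + Y \<in> vector_fields M"
  using subspace_add[OF subspace_tangent_space] smooth_functions_add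
  by (fastforce simp: vector_fields_def vf_apply_def plus_fun_def)

lemma vector_fields_fun_scale:
  "f \<in> smooth_functions M \<Longrightarrow> X \<in> vector_fields M \<Longrightarrow> fun_scale f X \<in> vector_fields M"
  using subspace_scale[OF subspace_tangent_space] smooth_functions_mult[of f]
  by (fastforce simp: vector_fields_def vf_apply_def fun_scale_def times_fun_def)

lemma vector_fields_sum:
  "(\<And>i. i \<in> I \<Longrightarrow> X i \<in> vector_fields M) \<Longrightarrow> (\<Sum>i\<in>I. X i) \<in> vector_fields M"
  by (induction I rule: infinite_finite_induct) (auto simp: vector_fields_zero vector_fields_add)

text \<open>
  Additivity of a connection extends to finite sums, the empty one included since \<open>D 0 X = D 0 X + D 0 X\<close>.
\<close>
lemma connection_sum:
  assumes D: "affine_connection M D" and X: "X \<in> vector_fields M"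
    and Y: "\<And>i. i \<in> I \<Longrightarrow> Y i \<in> vector_fields M"
  shows "D (\<Sum>i\<in>I. Y i) X = (\<Sum>i\<in>I. D (Y i) X)"
    and "D X (\<Sum>i\<in>I. Y i) = (\<Sum>i\<in>I. D X (Y i))"
proof -
  have add: "D (Y + Z) X = D Y X + D Z X" "D X (Y + Z) = D X Y + D X Z"
    if "Y \<in> vector_fields M" "Z \<in> vector_fields M" for Y Z
    using D X that unfolding affine_connection_def by blast+
  have zero: "D 0 X = 0" "D X 0 = 0"
    using add[OF vector_fields_zero vector_fields_zero] by simp_all
  show "D (\<Sum>i\<in>I. Y i) X = (\<Sum>i\<in>I. D (Y i) X)" "D X (\<Sum>i\<in>I. Y i) = (\<Sum>i\<in>I. D X (Y i))"
    using Y by (induction I rule: infinite_finite_induct) (simp_all add: zero add vector_fields_sum)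
qed

end

section \<open>Laplacians in a left-invariant frame\<close>

locale framed_lie_group = lie_group M mul one iv
  for M :: "('g::{t2_space, second_countable_topology}, 'b::real_inner) atlas"
    and mul :: "'g \<Rightarrow> 'g \<Rightarrow> 'g" and one :: 'g and iv :: "'g \<Rightarrow> 'g" +
  fixes g :: "'g metric_tensor" and I :: "'i set" and A :: "'i \<Rightarrow> 'g vector_field"
    and ginv :: "'i \<Rightarrow> 'i \<Rightarrow> 'g \<Rightarrow> real"
  assumes metric: "left_invariant_metric M mul g"
    and frame: "left_invariant_frame M mul I A"
    and gram: "inverse_gram I (\<lambda>i. A i p) (g p) (\<lambda>i j. ginv i j p)"
begin

lemma finite_I: "finite I"
  using frame by (simp add: left_invariant_frame_def)

lemma frame_left_invariant: "i \<in> I \<Longrightarrow> A i \<in> left_invariant_fields M mul"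
  using frame span_base[of "A i" "A ` I"] by (auto simp: left_invariant_frame_def)

lemma frame_vector_field: "i \<in> I \<Longrightarrow> A i \<in> vector_fields M"
  using frame_left_invariant by (auto simp: left_invariant_fields_def)

lemma frame_tangent: "i \<in> I \<Longrightarrow> A i p \<in> tangent_space M p"
  by (rule vector_fields_tangent[OF frame_vector_field])

text \<open>
  A basis of the left-invariant fields spans each tangent space, because evaluation at \<open>p\<close> maps the
  left-invariant fields onto it.
\<close>
lemma span_frame: "span ((\<lambda>i. A i p) ` I) = tangent_space M p"
proof
  show "span ((\<lambda>i. A i p) ` I) \<subseteq> tangent_space M p"
    by (rule span_minimal[OF _ subspace_tangent_space]) (auto simp: frame_tangent)
  show "tangent_space M p \<subseteq> span ((\<lambda>i. A i p) ` I)"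
  proof
    fix v assume "v \<in> tangent_space M p"
    then obtain X where X: "X \<in> left_invariant_fields M mul" "X p = v"
      by (rule left_invariant_extension)
    then have "X \<in> span (A ` I)" using frame by (simp add: left_invariant_frame_def)
    then have "X p \<in> span ((\<lambda>i. A i p) ` I)"
    proof (induction rule: span_induct_alt)
      case base
      show ?case by (subst zero_fun_apply) (rule span_zero)
    next
      case (step c x y)
      then have "x p \<in> span ((\<lambda>i. A i p) ` I)" by (intro span_base) auto
      from span_add[OF span_scale[OF this, of c] step(2)] show ?case by (subst plus_fun_apply, subst scaleR_fun_apply)
    qed
    then show "v \<in> span ((\<lambda>i. A i p) ` I)" using X(2) by simp
  qed
qed

lemma riemannian: "riemannian_metric M g"
  using metric by (simp add: left_invariant_metric_def)

lemma metric_lin: "u \<in> tangent_space M p \<Longrightarrow> v \<in> tangent_space M p \<Longrightarrow> w \<in> tangent_space M p \<Longrightarrow>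
    g p (r *\<^sub>R u + s *\<^sub>R v) w = r * g p u w + s * g p v w"
  and metric_sym: "v \<in> tangent_space M p \<Longrightarrow> w \<in> tangent_space M p \<Longrightarrow> g p v w = g p w v"
  and metric_smooth: "X \<in> vector_fields M \<Longrightarrow> Y \<in> vector_fields M \<Longrightarrow>
    (\<lambda>p. g p (X p) (Y p)) \<in> smooth_functions M"
  using riemannian unfolding riemannian_metric_def by blast+

text \<open>
  Translation by \<open>p\<close> is an isometry that carries the frame at the unit element to the frame at \<open>p\<close>.
\<close>
lemma metric_frame_const:
  assumes "i \<in> I" "j \<in> I"
  shows "g p (A i p) (A j p) = g one (A i one) (A j one)"
proof -
  have "pushforward M (mul p) (A i one) = A i p" if "i \<in> I" for i
    using frame_left_invariant[OF that] by (simp add: left_invariant_fields_def right_neutral)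
  moreover have "g (mul p one) (pushforward M (mul p) (A i one)) (pushforward M (mul p) (A j one))
      = g one (A i one) (A j one)"
    using metric frame_tangent assms unfolding left_invariant_metric_def by blast
  ultimately show ?thesis using assms by (simp add: right_neutral)
qed

lemma ginv_const: "i \<in> I \<Longrightarrow> j \<in> I \<Longrightarrow> ginv i j p = ginv i j one"
  using inverse_gram_unique[OF finite_I gram[of p] gram[of one], of i j] metric_frame_const[of _ _ p]
  by blast

lemma ginv_sym:
  assumes "i \<in> I" "j \<in> I"
  shows "ginv i j p = ginv j i p"
proof (rule inverse_gram_unique[OF finite_I gram[of p] _ _ assms])
  show "inverse_gram I (\<lambda>i. A i p) (g p) (\<lambda>i j. ginv j i p)"
    using gram[of p] metric_sym[OF frame_tangent frame_tangent]
    unfolding inverse_gram_def by (simp add: mult.commute cong: sum.cong)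
qed auto

lemma ginv_sym_const: "i \<in> I \<Longrightarrow> j \<in> I \<Longrightarrow> ginv i j one = ginv j i p"
  by (metis ginv_const ginv_sym)

text \<open>
  The dual coframe, expressed by the metric so that its linearity and smoothness are those of \<open>g\<close>.
\<close>
definition coframe :: "'i \<Rightarrow> 'g \<Rightarrow> 'g tangent \<Rightarrow> real"
  where "coframe k p w = (\<Sum>l\<in>I. ginv k l p * g p w (A l p))"

lemma coframe_lin:
  assumes "u \<in> tangent_space M p" "v \<in> tangent_space M p"
  shows "coframe k p (r *\<^sub>R u + s *\<^sub>R v) = r * coframe k p u + s * coframe k p v"
  unfolding coframe_def
  by (simp add: metric_lin[OF assms frame_tangent] sum.distrib sum_distrib_left algebra_simps cong: sum.cong)

lemma coframe_sum:
  assumes "\<And>j. j \<in> J \<Longrightarrow> w j \<in> tangent_space M p"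
  shows "coframe k p (\<Sum>j\<in>J. a j *\<^sub>R w j) = (\<Sum>j\<in>J. a j * coframe k p (w j))"
  using assms
proof (induction J rule: infinite_finite_induct)
  case (insert j J)
  have "(\<Sum>j\<in>J. a j *\<^sub>R w j) \<in> tangent_space M p"
    by (intro subspace_sum[OF subspace_tangent_space] subspace_scale[OF subspace_tangent_space] insert.prems) auto
  then have "coframe k p (a j *\<^sub>R w j + 1 *\<^sub>R (\<Sum>j\<in>J. a j *\<^sub>R w j)) =
      a j * coframe k p (w j) + 1 * coframe k p (\<Sum>j\<in>J. a j *\<^sub>R w j)"
    by (intro coframe_lin insert.prems) auto
  then show ?case
    using insert.hyps insert.IH insert.prems by (simp only: sum.insert scaleR_one mult_1 insert_iff simp_thms)
qed (use coframe_lin[OF subspace_0[OF subspace_tangent_space] subspace_0[OF subspace_tangent_space], of k p 0 0] in auto)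

lemma coframe_frame: "k \<in> I \<Longrightarrow> j \<in> I \<Longrightarrow> coframe k p (A j p) = (if k = j then 1 else 0)"
  using gram[of p] metric_sym[OF frame_tangent frame_tangent, of j _ p]
  unfolding coframe_def inverse_gram_def by (simp cong: sum.cong)

lemma coframe_frame_sum:
  assumes "k \<in> I"
  shows "coframe k p (\<Sum>j\<in>I. a j *\<^sub>R A j p) = a k"
proof -
  have "coframe k p (\<Sum>j\<in>I. a j *\<^sub>R A j p) = (\<Sum>j\<in>I. a j * coframe k p (A j p))"
    by (rule coframe_sum) (rule frame_tangent)
  also have "\<dots> = (\<Sum>j\<in>I. if k = j then a j else 0)"
    by (intro sum.cong refl) (simp add: coframe_frame assms)
  also have "\<dots> = a k" using finite_I assms by simp
  finally show ?thesis .
qed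

lemma coframe_expand:
  assumes "w \<in> tangent_space M p"
  shows "w = (\<Sum>k\<in>I. coframe k p w *\<^sub>R A k p)"
proof -
  have "w \<in> span ((\<lambda>i. A i p) ` I)" using assms span_frame by simp
  then obtain a where w: "w = (\<Sum>k\<in>I. a k *\<^sub>R A k p)"
  proof (induction arbitrary: thesis rule: span_induct_alt)
    case base
    show ?case by (rule base[of "\<lambda>k. 0"]) simp
  next
    case (step c x y)
    obtain a where a: "y = (\<Sum>k\<in>I. a k *\<^sub>R A k p)" by (rule step(2))
    obtain j where j: "j \<in> I" "x = A j p" using step(1) by blast
    have "(\<Sum>k\<in>I. (if k = j then c else 0) *\<^sub>R A k p) = (\<Sum>k\<in>I. if k = j then c *\<^sub>R x else 0)"
      by (intro sum.cong refl) (simp only: j(2) scaleR_zero_left split: if_split, blast)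
    also have "\<dots> = c *\<^sub>R x" using j(1) finite_I by (simp only: sum.delta if_True)
    finally have "(\<Sum>k\<in>I. (if k = j then c else 0) *\<^sub>R A k p) = c *\<^sub>R x" .
    then have "c *\<^sub>R x + y = (\<Sum>k\<in>I. ((if k = j then c else 0) + a k) *\<^sub>R A k p)"
      unfolding a by (simp only: scaleR_add_left sum.distrib)
    then show ?case by (rule step(3))
  qed
  then show ?thesis using coframe_frame_sum by simp
qed

lemma coframe_smooth:
  assumes "k \<in> I" "Z \<in> vector_fields M"
  shows "(\<lambda>p. coframe k p (Z p)) \<in> smooth_functions M"
proof -
  have "(\<Sum>l\<in>I. ginv k l one *\<^sub>R (\<lambda>p. g p (Z p) (A l p))) \<in> smooth_functions M"
    by (intro smooth_functions_sum smooth_functions_scaleR metric_smooth assms frame_vector_field)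
  also have "(\<Sum>l\<in>I. ginv k l one *\<^sub>R (\<lambda>p. g p (Z p) (A l p))) = (\<lambda>p. coframe k p (Z p))"
    unfolding coframe_def
    by (rule ext, simp only: sum_fun_apply scaleR_fun_apply real_scaleR_def)
      (intro sum.cong refl arg_cong2[where f="(*)"] ginv_const[OF assms(1), symmetric])
  finally show ?thesis .
qed

text \<open>
  A field \<open>Z\<close> is globally the combination of the frame fields with the smooth coefficients \<open>\<theta>\<^sup>k(Z)\<close>. As
  \<open>D\<close> is linear over smooth functions in its first argument, the value of \<open>D Z X\<close> at \<open>p\<close> only depends on the
  coefficients at \<open>p\<close>; so the field selected by the choice operator may be replaced by any other extension
  of \<open>w\<close>.
\<close>
lemma covariant_derivative_at_eq:
  assumes D: "affine_connection M D" and X: "X \<in> vector_fields M" and w: "w \<in> tangent_space M p"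
  shows "covariant_derivative_at M D X p w = (\<Sum>k\<in>I. coframe k p w *\<^sub>R D (A k) X p)"
proof -
  define Z where "Z = (SOME Z. Z \<in> vector_fields M \<and> Z p = w)"
  have "\<exists>Z. Z \<in> vector_fields M \<and> Z p = w"
    using left_invariant_extension[OF w] by (metis (no_types, lifting) left_invariant_fields_def mem_Collect_eq)
  then have Z: "Z \<in> vector_fields M" "Z p = w"
    unfolding Z_def by (metis (mono_tags, lifting) someI_ex)+
  have "Z = (\<Sum>k\<in>I. fun_scale (\<lambda>p. coframe k p (Z p)) (A k))"
    using coframe_expand[OF vector_fields_tangent[OF Z(1)]]
    by (intro ext[of Z]) (simp add: sum_fun_apply[of _ I] fun_scale_def)
  then have "D Z X = D (\<Sum>k\<in>I. fun_scale (\<lambda>p. coframe k p (Z p)) (A k)) X" by simp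
  also have "\<dots> = (\<Sum>k\<in>I. D (fun_scale (\<lambda>p. coframe k p (Z p)) (A k)) X)"
    by (intro connection_sum[OF D X] vector_fields_fun_scale coframe_smooth Z frame_vector_field)
  also have "\<dots> = (\<Sum>k\<in>I. fun_scale (\<lambda>p. coframe k p (Z p)) (D (A k) X))"
    using D X coframe_smooth[OF _ Z(1)] frame_vector_field unfolding affine_connection_def
    by (intro sum.cong refl) blast
  finally have "D Z X p = (\<Sum>k\<in>I. coframe k p w *\<^sub>R D (A k) X p)"
    by (simp add: sum_fun_apply[of _ I p] fun_scale_def Z(2))
  then show ?thesis by (simp add: covariant_derivative_at_def Z_def)
qed

lemma connection_vector_field:
  "affine_connection M D \<Longrightarrow> X \<in> vector_fields M \<Longrightarrow> Y \<in> vector_fields M \<Longrightarrow> D X Y \<in> vector_fields M"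
  by (simp add: affine_connection_def)

lemma divergence_eq:
  assumes D: "affine_connection M D" and X: "X \<in> vector_fields M"
  shows "divergence M D X p = (\<Sum>k\<in>I. coframe k p (D (A k) X p))"
  unfolding divergence_def
proof (rule endo_trace_eq_sum[where e="\<lambda>i. A i p" and \<theta>="\<lambda>i. coframe i p" and t="\<lambda>k. D (A k) X p",
      OF finite_I subspace_tangent_space])
  fix k :: 'i and B :: "'g tangent set" and a
  assume "B \<subseteq> tangent_space M p"
  then show "coframe k p (\<Sum>b\<in>B. a b *\<^sub>R b) = (\<Sum>b\<in>B. a b * coframe k p b)"
    by (intro coframe_sum) blast
next
  show "w = (\<Sum>k\<in>I. coframe k p w *\<^sub>R A k p)" if "w \<in> tangent_space M p" for w
    by (rule coframe_expand[OF that])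
  show "covariant_derivative_at M D X p w = (\<Sum>k\<in>I. coframe k p w *\<^sub>R D (A k) X p)"
    if "w \<in> tangent_space M p" for w
    by (rule covariant_derivative_at_eq[OF D X that])
  show "A i p \<in> tangent_space M p" "D (A i) X p \<in> tangent_space M p" if "i \<in> I" for i
    by (rule frame_tangent[OF that],
        rule vector_fields_tangent[OF connection_vector_field[OF D frame_vector_field[OF that] X]])
qed

text \<open>
  The formula for the gradient at single points, as an identity of vector fields to which the connection
  can be applied; the coefficients of the dual metric are taken at the unit element to make them constants.
\<close>
lemma gradient_eq:
  "gradient M g U = (\<Sum>j\<in>I. fun_scale (\<lambda>p. \<Sum>i\<in>I. ginv i j one * A i p U) (A j))"
proof
  fix p
  have "gradient M g U p = (\<Sum>i\<in>I. \<Sum>j\<in>I. (ginv i j p * A i p U) *\<^sub>R A j p)"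
    by (rule gradient_frame[where e="\<lambda>i. A i p" and h="\<lambda>i j. ginv i j p", OF riemannian finite_I span_frame gram])
  also have "\<dots> = (\<Sum>j\<in>I. \<Sum>i\<in>I. (ginv i j one * A i p U) *\<^sub>R A j p)"
    by (subst sum.swap) (intro sum.cong refl, simp add: ginv_const[of _ _ p])
  also have "\<dots> = (\<Sum>j\<in>I. fun_scale (\<lambda>p. \<Sum>i\<in>I. ginv i j one * A i p U) (A j)) p"
    by (simp add: sum_fun_apply[of _ I p] fun_scale_def scaleR_sum_left)
  finally show "gradient M g U p = (\<Sum>j\<in>I. fun_scale (\<lambda>p. \<Sum>i\<in>I. ginv i j one * A i p U) (A j)) p" .
qed

text \<open>
  With \<open>u\<^sup>j = g\<^sup>i\<^sup>j A\<^sub>i U\<close>, the Leibniz rule gives \<open>D\<^bsub>A\<^sub>k\<^esub> (u\<^sup>j A\<^sub>j) = u\<^sup>j D\<^bsub>A\<^sub>k\<^esub> A\<^sub>j + (A\<^sub>k u\<^sup>j) A\<^sub>j\<close>. In the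
  trace over \<open>k\<close> the second term becomes \<open>A\<^sub>k u\<^sup>k\<close>, and \<open>A\<^sub>k\<close> passes through the constant \<open>g\<^sup>i\<^sup>k\<close>. Both
  terms acquire the stated form by the symmetry of \<open>g\<^sup>i\<^sup>j\<close>.
\<close>
lemma laplacian_eq:
  assumes D: "affine_connection M D" and U: "U \<in> smooth_functions M"
  shows "laplacian M g D U p =
    (\<Sum>i\<in>I. \<Sum>j\<in>I. ginv i j p * vf_apply (A i) (vf_apply (A j) U) p) +
    (\<Sum>i\<in>I. \<Sum>j\<in>I. (\<Sum>k\<in>I. coframe k p (D (A k) (A i) p)) * ginv i j p * vf_apply (A j) U p)"
proof -
  define u where "u j = (\<Sum>i\<in>I. ginv i j one *\<^sub>R (\<lambda>p. A i p U))" for j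
  have Au: "(\<lambda>p. A i p U) \<in> smooth_functions M" if "i \<in> I" for i
    by (rule vector_fields_apply[OF frame_vector_field[OF that] U])
  have u: "u j \<in> smooth_functions M" for j
    unfolding u_def by (intro smooth_functions_sum smooth_functions_scaleR Au)
  have u_p: "u j p = (\<Sum>i\<in>I. ginv j i p * A i p U)" if "j \<in> I" for j p
  proof -
    have "u j p = (\<Sum>i\<in>I. ginv i j one * A i p U)" by (simp add: u_def sum_fun_apply)
    also have "\<dots> = (\<Sum>i\<in>I. ginv j i p * A i p U)"
      by (intro sum.cong refl arg_cong2[where f="(*)"] ginv_sym_const that)
    finally show ?thesis .
  qed
  have Aku: "A k p (u k) = (\<Sum>i\<in>I. ginv k i p * A k p (\<lambda>p. A i p U))" if k: "k \<in> I" for k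
  proof -
    have "A k p (u k) = (\<Sum>i\<in>I. A k p (ginv i k one *\<^sub>R (\<lambda>p. A i p U)))"
      unfolding u_def by (intro tangent_sum[OF frame_tangent[OF k]] smooth_functions_scaleR Au)
    also have "\<dots> = (\<Sum>i\<in>I. ginv i k one * A k p (\<lambda>p. A i p U))"
      by (intro sum.cong refl tangent_scaleR[OF frame_tangent[OF k]] Au)
    also have "\<dots> = (\<Sum>i\<in>I. ginv k i p * A k p (\<lambda>p. A i p U))"
      by (intro sum.cong refl arg_cong2[where f="(*)"] ginv_sym_const k)
    finally show ?thesis .
  qed
  have grad: "gradient M g U = (\<Sum>j\<in>I. fun_scale (u j) (A j))"
    unfolding gradient_eq u_def by (intro sum.cong refl arg_cong2[where f=fun_scale] ext) (simp add: sum_fun_apply)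
  have uA: "fun_scale (u j) (A j) \<in> vector_fields M" if "j \<in> I" for j
    by (intro vector_fields_fun_scale u frame_vector_field that)
  have DA: "D (A k) (A j) p \<in> tangent_space M p" if "k \<in> I" "j \<in> I" for k j
    by (rule vector_fields_tangent[OF connection_vector_field[OF D frame_vector_field[OF that(1)] frame_vector_field[OF that(2)]]])
  have step: "coframe k p (D (A k) (gradient M g U) p) =
      (\<Sum>j\<in>I. u j p * coframe k p (D (A k) (A j) p)) + A k p (u k)" if k: "k \<in> I" for k
  proof -
    have "D (A k) (gradient M g U) = (\<Sum>j\<in>I. D (A k) (fun_scale (u j) (A j)))"
      unfolding grad by (rule connection_sum[OF D frame_vector_field[OF k] uA])
    also have "\<dots> = (\<Sum>j\<in>I. fun_scale (u j) (D (A k) (A j)) + fun_scale (vf_apply (A k) (u j)) (A j))"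
      using D k u frame_vector_field unfolding affine_connection_def
      by (intro sum.cong refl) blast
    finally have "D (A k) (gradient M g U) p =
        (\<Sum>j\<in>I. u j p *\<^sub>R D (A k) (A j) p) + (\<Sum>j\<in>I. A k p (u j) *\<^sub>R A j p)"
      by (simp only: sum_fun_apply[of _ I p] fun_scale_def vf_apply_def sum.distrib plus_fun_apply)
    moreover have "(\<Sum>j\<in>I. u j p *\<^sub>R D (A k) (A j) p) \<in> tangent_space M p"
      by (intro subspace_sum[OF subspace_tangent_space] subspace_scale[OF subspace_tangent_space] DA k)
    moreover have "(\<Sum>j\<in>I. A k p (u j) *\<^sub>R A j p) \<in> tangent_space M p"
      by (intro subspace_sum[OF subspace_tangent_space] subspace_scale[OF subspace_tangent_space]
          frame_tangent)
    ultimately have "coframe k p (D (A k) (gradient M g U) p) =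
        coframe k p (\<Sum>j\<in>I. u j p *\<^sub>R D (A k) (A j) p) + coframe k p (\<Sum>j\<in>I. A k p (u j) *\<^sub>R A j p)"
      using coframe_lin[of "\<Sum>j\<in>I. u j p *\<^sub>R D (A k) (A j) p" p "\<Sum>j\<in>I. A k p (u j) *\<^sub>R A j p" k 1 1]
      by (simp only: scaleR_one mult_1)
    then show ?thesis
      by (simp only: coframe_frame_sum[OF k]) (simp only: coframe_sum[OF DA[OF k]])
  qed
  have "laplacian M g D U p = (\<Sum>k\<in>I. coframe k p (D (A k) (gradient M g U) p))"
    unfolding laplacian_def by (rule divergence_eq[OF D]) (unfold grad, intro vector_fields_sum uA)
  also have "\<dots> = (\<Sum>k\<in>I. \<Sum>j\<in>I. u j p * coframe k p (D (A k) (A j) p)) + (\<Sum>k\<in>I. A k p (u k))"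
    by (simp add: step sum.distrib cong: sum.cong)
  also have "(\<Sum>k\<in>I. \<Sum>j\<in>I. u j p * coframe k p (D (A k) (A j) p)) =
      (\<Sum>j\<in>I. u j p * (\<Sum>k\<in>I. coframe k p (D (A k) (A j) p)))"
    by (subst sum.swap) (simp add: sum_distrib_left)
  also have "\<dots> = (\<Sum>i\<in>I. \<Sum>j\<in>I. (\<Sum>k\<in>I. coframe k p (D (A k) (A i) p)) * ginv i j p * vf_apply (A j) U p)"
    by (intro sum.cong refl, subst u_p, assumption, subst sum_distrib_right, intro sum.cong refl)
      (simp add: vf_apply_def mult_ac)
  also have "(\<Sum>k\<in>I. A k p (u k)) = (\<Sum>i\<in>I. \<Sum>j\<in>I. ginv i j p * vf_apply (A i) (vf_apply (A j) U) p)"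
    by (intro sum.cong refl) (simp add: Aku vf_apply_def)
  finally show ?thesis by simp
qed

text \<open>
  Differentiating the constant \<open>g(A\<^sub>k, A\<^sub>l)\<close> along \<open>A\<^sub>i\<close> shows that \<open>g(D\<^bsub>A\<^sub>i\<^esub> A\<^sub>k, A\<^sub>l)\<close> is skew in \<open>k\<close> and \<open>l\<close>.
  The trace is its contraction with the symmetric \<open>g\<^sup>k\<^sup>l\<close>.
\<close>
lemma metric_connection_trace_zero:
  assumes LC: "levi_civita_connection M g D" and i: "i \<in> I"
  shows "(\<Sum>k\<in>I. coframe k p (D (A i) (A k) p)) = 0"
proof -
  have D: "affine_connection M D" using LC by (simp add: levi_civita_connection_def)
  let ?G = "\<lambda>k l. g p (D (A i) (A k) p) (A l p)"
  have DT: "D (A i) (A k) p \<in> tangent_space M p" if "k \<in> I" for k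
    by (rule vector_fields_tangent[OF connection_vector_field[OF D frame_vector_field[OF i] frame_vector_field[OF that]]])
  have skew: "?G k l + ?G l k = 0" if k: "k \<in> I" and l: "l \<in> I" for k l
  proof -
    have "vf_apply (A i) (\<lambda>p. g p (A k p) (A l p)) =
        (\<lambda>p. g p (D (A i) (A k) p) (A l p) + g p (A k p) (D (A i) (A l) p))"
      using LC frame_vector_field i k l unfolding levi_civita_connection_def by blast
    from fun_cong[OF this, of p]
    have "A i p (\<lambda>p. g p (A k p) (A l p)) = ?G k l + ?G l k"
      using metric_sym[OF frame_tangent[OF k] DT[OF l]] by (simp add: vf_apply_def)
    moreover have "(\<lambda>p. g p (A k p) (A l p)) = (\<lambda>p. g one (A k one) (A l one))"
      by (rule ext) (rule metric_frame_const[OF k l])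
    ultimately show ?thesis using tangent_const[OF frame_tangent[OF i]] by simp
  qed
  let ?S = "\<Sum>k\<in>I. \<Sum>l\<in>I. ginv k l p * ?G k l"
  have "?S = (\<Sum>k\<in>I. \<Sum>l\<in>I. ginv k l p * ?G l k)"
    by (subst sum.swap) (intro sum.cong refl, simp add: ginv_sym)
  also have "\<dots> = (\<Sum>k\<in>I. \<Sum>l\<in>I. - (ginv k l p * ?G k l))"
  proof (intro sum.cong refl)
    fix k l assume "k \<in> I" "l \<in> I"
    then have "?G l k = - ?G k l" using skew[of k l] by linarith
    then show "ginv k l p * ?G l k = - (ginv k l p * ?G k l)" by simp
  qed
  finally have "?S = - ?S" by (simp add: sum_negf)
  then show ?thesis by (simp add: coframe_def)
qed

text \<open>
  The two traces differ, as the torsion vanishes, by the trace of \<open>D\<^bsub>A\<^sub>i\<^esub> A\<^sub>k\<close> over \<open>k\<close>, which is zero.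
\<close>
lemma levi_civita_trace:
  assumes LC: "levi_civita_connection M g D" and i: "i \<in> I"
  shows "(\<Sum>k\<in>I. coframe k p (D (A k) (A i) p)) = (\<Sum>k\<in>I. coframe k p (lie_bracket (A k) (A i) p))"
proof -
  have D: "affine_connection M D" using LC by (simp add: levi_civita_connection_def)
  have "coframe k p (lie_bracket (A k) (A i) p) =
      coframe k p (D (A k) (A i) p) - coframe k p (D (A i) (A k) p)" if k: "k \<in> I" for k
  proof -
    have "D (A k) (A i) - D (A i) (A k) = lie_bracket (A k) (A i)"
      using LC frame_vector_field i k unfolding levi_civita_connection_def by blast
    then have "lie_bracket (A k) (A i) p = 1 *\<^sub>R D (A k) (A i) p + (- 1) *\<^sub>R D (A i) (A k) p"
      by (metis fun_diff_def scaleR_minus1_left scaleR_one diff_conv_add_uminus)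
    then show ?thesis
      using coframe_lin[of "D (A k) (A i) p" p "D (A i) (A k) p" k 1 "- 1"]
        vector_fields_tangent connection_vector_field[OF D] frame_vector_field i k by simp
  qed
  then have "(\<Sum>k\<in>I. coframe k p (lie_bracket (A k) (A i) p)) =
      (\<Sum>k\<in>I. coframe k p (D (A k) (A i) p)) - (\<Sum>k\<in>I. coframe k p (D (A i) (A k) p))"
    by (simp add: sum_subtractf)
  then show ?thesis using metric_connection_trace_zero[OF LC i] by simp
qed

end

section \<open>The Lie-Cartan Laplacian and the Laplace-Beltrami operator\<close>

theorem theorem1:
  fixes M :: "('g::{t2_space, second_countable_topology}, 'b::real_inner) atlas"
    and mul :: "'g \<Rightarrow> 'g \<Rightarrow> 'g" and one :: 'g and iv :: "'g \<Rightarrow> 'g"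
    and g :: "'g metric_tensor" and \<nu> :: real
    and I :: "'i set" and A :: "'i \<Rightarrow> 'g vector_field"
    and c :: "'i \<Rightarrow> 'i \<Rightarrow> 'i \<Rightarrow> real"
    and ginv :: "'i \<Rightarrow> 'i \<Rightarrow> 'g \<Rightarrow> real"
    and \<Gamma> :: "'i \<Rightarrow> 'i \<Rightarrow> 'i \<Rightarrow> 'g \<Rightarrow> real"
    and D\<nu> D\<^sub>L\<^sub>C :: "'g connection"
  assumes "lie_group M mul one iv"
    and "connected (UNIV :: 'g set)"
    and "left_invariant_metric M mul g"
    and "left_invariant_frame M mul I A"
    and "\<forall>i\<in>I. \<forall>j\<in>I. lie_bracket (A i) (A j) = (\<Sum>k\<in>I. c i j k *\<^sub>R A k)"
    and "\<forall>p. inverse_gram I (\<lambda>i. A i p) (g p) (\<lambda>i j. ginv i j p)"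
    and "lie_cartan_connection M mul \<nu> D\<nu>"
    and "levi_civita_connection M g D\<^sub>L\<^sub>C"
    and "\<forall>i\<in>I. \<forall>j\<in>I. D\<^sub>L\<^sub>C (A i) (A j) = (\<Sum>k\<in>I. fun_scale (\<Gamma> i j k) (A k))"
  shows
    "\<forall>U\<in>smooth_functions M. \<forall>p.
      laplacian M g D\<nu> U p =
        (\<Sum>i\<in>I. \<Sum>j\<in>I. ginv i j p * vf_apply (A i) (vf_apply (A j) U) p) +
        \<nu> * (\<Sum>i\<in>I. \<Sum>j\<in>I. \<Sum>k\<in>I. c k i k * ginv i j p * vf_apply (A j) U p)
    \<and> laplacian M g D\<^sub>L\<^sub>C U p =
        (\<Sum>i\<in>I. \<Sum>j\<in>I. ginv i j p * vf_apply (A i) (vf_apply (A j) U) p) +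
        (\<Sum>i\<in>I. \<Sum>j\<in>I. \<Sum>k\<in>I. \<Gamma> k i k p * ginv i j p * vf_apply (A j) U p)
    \<and> laplacian M g D\<^sub>L\<^sub>C U p =
        (\<Sum>i\<in>I. \<Sum>j\<in>I. ginv i j p * vf_apply (A i) (vf_apply (A j) U) p) +
        (\<Sum>i\<in>I. \<Sum>j\<in>I. \<Sum>k\<in>I. c k i k * ginv i j p * vf_apply (A j) U p)
    \<and> laplacian M g D\<^sub>L\<^sub>C U p - laplacian M g D\<nu> U p =
        (1 - \<nu>) * (\<Sum>i\<in>I. \<Sum>j\<in>I. \<Sum>k\<in>I. c k i k * ginv i j p * vf_apply (A j) U p)"
proof (intro ballI allI)
  interpret framed_lie_group M mul one iv g I A ginv
    using assms(1,3,4,6) by (simp add: framed_lie_group_def framed_lie_group_axioms_def)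
  fix U p assume U: "U \<in> smooth_functions M"
  let ?AA = "\<Sum>i\<in>I. \<Sum>j\<in>I. ginv i j p * vf_apply (A i) (vf_apply (A j) U) p"
  let ?first_order = "\<lambda>t. \<Sum>i\<in>I. \<Sum>j\<in>I. \<Sum>k\<in>I. t k i * ginv i j p * vf_apply (A j) U p"
  have lap: "laplacian M g D U p = ?AA + ?first_order t"
    if "affine_connection M D"
      and "\<And>i. i \<in> I \<Longrightarrow> (\<Sum>k\<in>I. coframe k p (D (A k) (A i) p)) = (\<Sum>k\<in>I. t k i)" for D t
    unfolding laplacian_eq[OF that(1) U] using that(2) by (simp add: sum_distrib_right cong: sum.cong)
  have bracket: "coframe k p (lie_bracket (A k) (A i) p) = c k i k" if "k \<in> I" "i \<in> I" for k i
    using assms(5) that coframe_frame_sum[OF that(1), of p "c k i"]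
    by (simp add: sum_fun_apply[of _ I p])
  have "affine_connection M D\<nu>" using assms(7) by (simp add: lie_cartan_connection_def)
  then have nu: "laplacian M g D\<nu> U p = ?AA + ?first_order (\<lambda>k i. \<nu> * c k i k)"
  proof (rule lap, intro sum.cong refl)
    fix i k assume ik: "i \<in> I" "k \<in> I"
    then have "D\<nu> (A k) (A i) = \<nu> *\<^sub>R lie_bracket (A k) (A i)"
      using assms(7) frame_left_invariant unfolding lie_cartan_connection_def by blast
    then have "D\<nu> (A k) (A i) p = (\<Sum>j\<in>I. (\<nu> * c k i j) *\<^sub>R A j p)"
      using assms(5) ik by (simp add: sum_fun_apply[of _ I p] scaleR_sum_right)
    then show "coframe k p (D\<nu> (A k) (A i) p) = \<nu> * c k i k"
      using coframe_frame_sum[OF ik(2)] by simp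
  qed
  have LC: "affine_connection M D\<^sub>L\<^sub>C" using assms(8) by (simp add: levi_civita_connection_def)
  then have gam: "laplacian M g D\<^sub>L\<^sub>C U p = ?AA + ?first_order (\<lambda>k i. \<Gamma> k i k p)"
  proof (rule lap, intro sum.cong refl)
    fix i k assume ik: "i \<in> I" "k \<in> I"
    then have "D\<^sub>L\<^sub>C (A k) (A i) p = (\<Sum>j\<in>I. \<Gamma> k i j p *\<^sub>R A j p)"
      using assms(9) by (simp add: sum_fun_apply[of _ I p] fun_scale_def)
    then show "coframe k p (D\<^sub>L\<^sub>C (A k) (A i) p) = \<Gamma> k i k p"
      using coframe_frame_sum[OF ik(2)] by simp
  qed
  from LC have c: "laplacian M g D\<^sub>L\<^sub>C U p = ?AA + ?first_order (\<lambda>k i. c k i k)"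
    by (rule lap) (simp add: levi_civita_trace[OF assms(8)] bracket)
  have nu': "?first_order (\<lambda>k i. \<nu> * c k i k) = \<nu> * ?first_order (\<lambda>k i. c k i k)"
    by (simp add: sum_distrib_left mult_ac)
  show "laplacian M g D\<nu> U p = ?AA + \<nu> * ?first_order (\<lambda>k i. c k i k)
    \<and> laplacian M g D\<^sub>L\<^sub>C U p = ?AA + ?first_order (\<lambda>k i. \<Gamma> k i k p)
    \<and> laplacian M g D\<^sub>L\<^sub>C U p = ?AA + ?first_order (\<lambda>k i. c k i k)
    \<and> laplacian M g D\<^sub>L\<^sub>C U p - laplacian M g D\<nu> U p = (1 - \<nu>) * ?first_order (\<lambda>k i. c k i k)"
    using nu gam c nu' by (simp add: algebra_simps)
qed

end
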